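(* Let $X=X(\mathcal{M},\mathcal{C})$ be a twisted 2-stratifold and let $K$ be a triangulation of $X$. If $f:K\to\mathbb{R}$ is a discrete Morse function, then $m_2(f)\ge|\mathcal{M}|$.
   Context: A (finite) 2-stratifold $X=X(\mathcal{M},\mathcal{C})$ is a compact connected Hausdorff space obtained from a finite collection $\mathcal{C}$ of circles and a finite collection $\mathcal{M}=\{\mathbb{M}_1,\dots,\mathbb{M}_n\}$ of compact connected surfaces with boundary by attaching each boundary component of each $\mathbb{M}_i$ to exactly one circle via a covering map $\mathbb{S}^1\to\mathbb{S}^1$ of some degree, where for each circle the sum of the absolute values of the degrees of the maps attached to it exceeds $2$. $X$ is twisted if every attaching map has degree different from $\pm1$. A discrete Morse function on a simplicial complex $K$ is $f:K\to\mathbb{R}$ such that for every $i$-simplex $\sigma$ at most one $(i+1)$-simplex $\tau>\sigma$ has $f(\tau)\le f(\sigma)$ and at most one $(i-1)$-face $\tau<\sigma$ has $f(\tau)\ge f(\sigma)$; $\sigma$ is critical if both counts are $0$, and $m_2(f)$ is the number of critical $2$-simplices. *)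

theory Defs
  imports "HOL-Analysis.Analysis"
begin

definition simplicial_complex :: "'v set set \<Rightarrow> bool" where
  "simplicial_complex K \<longleftrightarrow> finite K \<and>
     (\<forall>\<sigma>\<in>K. finite \<sigma> \<and> \<sigma> \<noteq> {}) \<and>
     (\<forall>\<sigma>\<in>K. \<forall>\<tau>. \<tau> \<subseteq> \<sigma> \<and> \<tau> \<noteq> {} \<longrightarrow> \<tau> \<in> K)"

text \<open>Geometric realization via barycentric coordinates: functions
  vertex \<Rightarrow> real, nonnegative, supported in a simplex, summing to 1,
  with the (Euclidean) product topology.\<close>
definition geometric_realization :: "'v set set \<Rightarrow> ('v \<Rightarrow> real) topology" where
  "geometric_realization K = subtopology (powertop_real UNIV)
     {\<alpha>. (\<forall>v. 0 \<le> \<alpha> v) \<and> (\<exists>\<sigma>\<in>K. {v. \<alpha> v \<noteq> 0} \<subseteq> \<sigma>) \<and> sum \<alpha> (\<Union>K) = 1}"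

definition triangulates :: "'v set set \<Rightarrow> 'x topology \<Rightarrow> bool" where
  "triangulates K X \<longleftrightarrow> simplicial_complex K \<and>
     (geometric_realization K) homeomorphic_space X"

text \<open>An i-simplex has i+1 vertices.\<close>
definition discrete_morse :: "'v set set \<Rightarrow> ('v set \<Rightarrow> real) \<Rightarrow> bool" where
  "discrete_morse K f \<longleftrightarrow> (\<forall>\<sigma>\<in>K.
     card {\<tau>\<in>K. \<sigma> \<subset> \<tau> \<and> card \<tau> = card \<sigma> + 1 \<and> f \<tau> \<le> f \<sigma>} \<le> 1 \<and>
     card {\<tau>\<in>K. \<tau> \<subset> \<sigma> \<and> card \<tau> + 1 = card \<sigma> \<and> f \<tau> \<ge> f \<sigma>} \<le> 1)"

definition critical :: "'v set set \<Rightarrow> ('v set \<Rightarrow> real) \<Rightarrow> 'v set \<Rightarrow> bool" where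
  "critical K f \<sigma> \<longleftrightarrow> \<sigma> \<in> K \<and>
     card {\<tau>\<in>K. \<sigma> \<subset> \<tau> \<and> card \<tau> = card \<sigma> + 1 \<and> f \<tau> \<le> f \<sigma>} = 0 \<and>
     card {\<tau>\<in>K. \<tau> \<subset> \<sigma> \<and> card \<tau> + 1 = card \<sigma> \<and> f \<tau> \<ge> f \<sigma>} = 0"

definition m2 :: "'v set set \<Rightarrow> ('v set \<Rightarrow> real) \<Rightarrow> nat" where
  "m2 K f = card {\<sigma>\<in>K. card \<sigma> = 3 \<and> critical K f \<sigma>}"

definition half_plane :: "(real \<times> real) topology" where
  "half_plane = subtopology euclidean {q. 0 \<le> snd q}"

definition surface_with_boundary :: "'a topology \<Rightarrow> bool" where
  "surface_with_boundary M \<longleftrightarrow> Hausdorff_space M \<and> second_countable M \<and>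
     (\<forall>x\<in>topspace M. \<exists>U V g. openin M U \<and> x \<in> U \<and> openin half_plane V \<and>
        homeomorphic_map (subtopology M U) (subtopology half_plane V) g)"

definition surf_boundary :: "'a topology \<Rightarrow> 'a set" where
  "surf_boundary M = {x\<in>topspace M. \<exists>U V g. openin M U \<and> x \<in> U \<and> openin half_plane V \<and>
        homeomorphic_map (subtopology M U) (subtopology half_plane V) g \<and> snd (g x) = 0}"

definition boundary_components :: "'a topology \<Rightarrow> 'a set set" where
  "boundary_components M = connected_components_of (subtopology M (surf_boundary M))"

definition circle :: "complex topology" where
  "circle = subtopology euclidean (sphere 0 1)"

definition covering_map :: "'a topology \<Rightarrow> 'b topology \<Rightarrow> ('a \<Rightarrow> 'b) \<Rightarrow> bool" where
  "covering_map E B p \<longleftrightarrow> continuous_map E B p \<and> p ` topspace E = topspace B \<and>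
     (\<forall>b\<in>topspace B. \<exists>U. openin B U \<and> b \<in> U \<and>
        (\<exists>\<V>. \<Union>\<V> = {x\<in>topspace E. p x \<in> U} \<and> pairwise disjnt \<V> \<and>
              (\<forall>V\<in>\<V>. openin E V \<and> homeomorphic_map (subtopology E V) (subtopology B U) p)))"

text \<open>Absolute value of the degree of a covering map onto the circle = number of sheets.\<close>
definition abs_degree :: "'a topology \<Rightarrow> ('a \<Rightarrow> complex) \<Rightarrow> nat" where
  "abs_degree E p = card {x\<in>topspace E. p x = 1}"

text \<open>X = X(M, C) with surfaces M 0, ..., M (n-1) and circles indexed 0..m-1
  (each a copy of the unit circle). The boundary component B of M i is attached to
  circle att i B via the covering map phi i B. The maps p i (surfaces) and r j
  (circles) into X exhibit X as the corresponding quotient of the disjoint union.\<close>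
definition twisted_two_stratifold ::
  "'x topology \<Rightarrow> nat \<Rightarrow> (nat \<Rightarrow> 'a topology) \<Rightarrow> nat \<Rightarrow> (nat \<Rightarrow> 'a set \<Rightarrow> nat) \<Rightarrow>
   (nat \<Rightarrow> 'a set \<Rightarrow> 'a \<Rightarrow> complex) \<Rightarrow> (nat \<Rightarrow> 'a \<Rightarrow> 'x) \<Rightarrow> (nat \<Rightarrow> complex \<Rightarrow> 'x) \<Rightarrow> bool" where
  "twisted_two_stratifold X n M m att phi p r \<longleftrightarrow>
     Hausdorff_space X \<and> compact_space X \<and> connected_space X \<and>
     (\<forall>i<n. surface_with_boundary (M i) \<and> compact_space (M i) \<and> connected_space (M i) \<and>
            surf_boundary (M i) \<noteq> {}) \<and>
     (\<forall>i<n. \<forall>B\<in>boundary_components (M i). att i B < m \<and>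
            covering_map (subtopology (M i) B) circle (phi i B) \<and>
            abs_degree (subtopology (M i) B) (phi i B) \<noteq> 1) \<and>
     (\<forall>j<m. (\<Sum>(i,B)\<in>{(i,B). i < n \<and> B \<in> boundary_components (M i) \<and> att i B = j}.
              abs_degree (subtopology (M i) B) (phi i B)) > 2) \<and>
     (\<forall>i<n. continuous_map (M i) X (p i)) \<and>
     (\<forall>j<m. continuous_map circle X (r j)) \<and>
     topspace X = (\<Union>i<n. p i ` topspace (M i)) \<union> (\<Union>j<m. r j ` topspace circle) \<and>
     (\<forall>U. U \<subseteq> topspace X \<longrightarrow>
        (openin X U \<longleftrightarrow> (\<forall>i<n. openin (M i) {x\<in>topspace (M i). p i x \<in> U}) \<and>
                          (\<forall>j<m. openin circle {z\<in>topspace circle. r j z \<in> U}))) \<and>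
     (\<forall>i<n. \<forall>B\<in>boundary_components (M i). \<forall>x\<in>B. p i x = r (att i B) (phi i B x)) \<and>
     (\<forall>i i' x x'. i < n \<and> i' < n \<and> x \<in> topspace (M i) - surf_boundary (M i) \<and>
        x' \<in> topspace (M i') - surf_boundary (M i') \<and> p i x = p i' x' \<longrightarrow> i = i' \<and> x = x') \<and>
     (\<forall>i x j z. i < n \<and> x \<in> topspace (M i) - surf_boundary (M i) \<and> j < m \<and>
        z \<in> topspace circle \<longrightarrow> p i x \<noteq> r j z) \<and>
     (\<forall>j j' z z'. j < m \<and> j' < m \<and> z \<in> topspace circle \<and> z' \<in> topspace circle \<and>
        r j z = r j' z' \<longrightarrow> j = j' \<and> z = z')"

end

theory Submission
  imports Defs
begin

text \<open>
  Write \<open>P\<^sub>i\<close> for the image of the \<open>i\<close>-th surface in \<open>X\<close>. Since every boundary curve wraps at least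
  twice around its circle, every point of \<open>P\<^sub>i\<close>, including those on the circles, is the center of a
  disc embedded in \<open>P\<^sub>i\<close>. By invariance of domain, a triangulation of \<open>X\<close> is then purely
  two-dimensional, every open triangle lies in exactly one \<open>P\<^sub>i\<close>, and every edge of a triangle in
  \<open>P\<^sub>i\<close> belongs to at least two triangles in \<open>P\<^sub>i\<close>. A triangle of \<open>P\<^sub>i\<close> on which a discrete Morse
  function is maximal is therefore critical: if it were paired with an edge, that edge would also
  have at least the value of a second adjacent triangle.
\<close>

section \<open>Critical triangles of discrete Morse functions\<close>

text \<open>The homeomorphism with the realization is arbitrary, so neither the circles nor the sets
  \<open>P\<^sub>i\<close> can be assumed to be subcomplexes. Moreover \<open>P\<^sub>i\<close>
  fails to be a surface where a boundary curve wraps three or more times, or where several of its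
  curves share a circle. The proof therefore asks for very little at a point: an injective
  continuous map of an open disc into \<open>P\<^sub>i\<close>, whose image may have empty interior
  in X. Two half discs suffice for it, and they exist as soon as a fibre of the attaching map has
  two points. With degree 1, \<open>P\<^sub>i\<close> could end along the circle, and a free edge
  there could be paired with the maximal triangle. Discs bound dimensions only from below. That no
  simplex has more than three vertices comes from the surface interiors, whose images are open,
  locally planar, and dense in the \<open>P\<^sub>i\<close>. Density, together with the disjointness
  of such an interior from the other sets \<open>P\<^sub>k\<close>, also keeps the critical
  triangles of different surfaces distinct.\<close>

lemma discrete_morse_critical_if_doubly_covered:
  assumes "finite K" and morse: "discrete_morse K f"
    and dim: "\<And>\<sigma>. \<sigma> \<in> K \<Longrightarrow> card \<sigma> \<le> 3"
    and T: "T \<subseteq> K" "T \<noteq> {}" "\<And>\<tau>. \<tau> \<in> T \<Longrightarrow> card \<tau> = 3"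
    and cofaces: "\<And>\<tau> e. \<lbrakk>\<tau> \<in> T; e \<subset> \<tau>; card e = 2\<rbrakk> \<Longrightarrow> \<exists>\<tau>'\<in>T. \<tau>' \<noteq> \<tau> \<and> e \<subset> \<tau>'"
  obtains \<tau> where "\<tau> \<in> T" "critical K f \<tau>"
proof -
  have finT: "finite T" using T(1) assms(1) finite_subset by blast
  have "Max (f ` T) \<in> f ` T" using finT T(2) by simp
  then obtain \<tau> where \<tau>: "\<tau> \<in> T" "f \<tau> = Max (f ` T)" by force
  have max: "f \<tau>' \<le> f \<tau>" if "\<tau>' \<in> T" for \<tau>' using that finT \<tau>(2) by simp
  \<comment> \<open>A coface of \<open>\<tau>\<close> would have four vertices.\<close>
  have up: "{\<rho>\<in>K. \<tau> \<subset> \<rho> \<and> card \<rho> = card \<tau> + 1 \<and> f \<rho> \<le> f \<tau>} = {}"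
    using dim T(3)[OF \<tau>(1)] by fastforce
  have down: "{e\<in>K. e \<subset> \<tau> \<and> card e + 1 = card \<tau> \<and> f e \<ge> f \<tau>} = {}"
  proof (rule ccontr)
    assume "\<not> ?thesis"
    then obtain e where e: "e \<in> K" "e \<subset> \<tau>" "card e = 2" "f e \<ge> f \<tau>"
      using T(3)[OF \<tau>(1)] by auto
    obtain \<tau>' where \<tau>': "\<tau>' \<in> T" "\<tau>' \<noteq> \<tau>" "e \<subset> \<tau>'" using cofaces[OF \<tau>(1) e(2,3)] by blast
    let ?A = "{\<rho>\<in>K. e \<subset> \<rho> \<and> card \<rho> = card e + 1 \<and> f \<rho> \<le> f e}"
    have "{\<tau>, \<tau>'} \<subseteq> ?A" using e \<tau>' \<tau>(1) T max[OF \<tau>'(1)] by auto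
    then have "card {\<tau>, \<tau>'} \<le> card ?A" by (intro card_mono) (use assms(1) in auto)
    moreover have "card ?A \<le> 1" using morse e(1) unfolding discrete_morse_def by blast
    ultimately show False using \<tau>'(2) by simp
  qed
  have "critical K f \<tau>"
    unfolding critical_def using \<tau>(1) T(1) by (simp only: up down) auto
  then show thesis using \<tau>(1) that by blast
qed

text \<open>Each family contributes one critical triangle, and disjointness makes the choice
  injective.\<close>

lemma m2_ge_disjoint_doubly_covered_families:
  assumes "finite K" and "discrete_morse K f"
    and "\<And>\<sigma>. \<sigma> \<in> K \<Longrightarrow> card \<sigma> \<le> 3"
    and T: "\<And>i. i < n \<Longrightarrow> T i \<subseteq> K" "\<And>i. i < n \<Longrightarrow> T i \<noteq> {}"
      "\<And>i \<tau>. \<lbrakk>i < n; \<tau> \<in> T i\<rbrakk> \<Longrightarrow> card \<tau> = 3"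
    and cofaces: "\<And>i \<tau> e. \<lbrakk>i < n; \<tau> \<in> T i; e \<subset> \<tau>; card e = 2\<rbrakk> \<Longrightarrow> \<exists>\<tau>'\<in>T i. \<tau>' \<noteq> \<tau> \<and> e \<subset> \<tau>'"
    and disj: "\<And>i k. \<lbrakk>i < n; k < n; i \<noteq> k\<rbrakk> \<Longrightarrow> T i \<inter> T k = {}"
  shows "n \<le> m2 K f"
proof -
  have "\<forall>i. \<exists>\<tau>. i < n \<longrightarrow> \<tau> \<in> T i \<and> critical K f \<tau>"
  proof (intro allI)
    fix i show "\<exists>\<tau>. i < n \<longrightarrow> \<tau> \<in> T i \<and> critical K f \<tau>"
    proof (cases "i < n")
      case True
      then show ?thesis
        using discrete_morse_critical_if_doubly_covered[of K f "T i"] assms(1-3) T[of i] cofaces[of i]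
        by metis
    qed auto
  qed
  then obtain t where t: "\<And>i. i < n \<Longrightarrow> t i \<in> T i \<and> critical K f (t i)" by metis
  have inj: "inj_on t {..<n}"
    by (rule inj_onI) (use t disj in \<open>metis disjoint_iff lessThan_iff\<close>)
  have "card (t ` {..<n}) \<le> card {\<sigma>\<in>K. card \<sigma> = 3 \<and> critical K f \<sigma>}"
    by (intro card_mono) (use t T assms(1) in auto)
  then show ?thesis by (simp add: card_image inj m2_def)
qed

section \<open>Geometric realizations\<close>

definition realization_points :: "'v set set \<Rightarrow> ('v \<Rightarrow> real) set" where
  "realization_points K =
     {\<alpha>. (\<forall>v. 0 \<le> \<alpha> v) \<and> (\<exists>\<sigma>\<in>K. {v. \<alpha> v \<noteq> 0} \<subseteq> \<sigma>) \<and> sum \<alpha> (\<Union>K) = 1}"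

text \<open>Rewriting the realization as a \<open>top_of_set\<close> of the function space makes
  \<open>continuous_on\<close> and relative openness available for it.\<close>

lemma geometric_realization_eq: "geometric_realization K = top_of_set (realization_points K)"
  by (simp add: geometric_realization_def realization_points_def euclidean_product_topology)

text \<open>Support equal to \<open>\<sigma>\<close>, rather than contained in it, gives the
  relative interior of the simplex. Every point of the realization lies in exactly one of these
  sets, the one of its carrier.\<close>

definition open_simplex :: "'v set \<Rightarrow> ('v \<Rightarrow> real) set" where
  "open_simplex \<sigma> = {\<alpha>. (\<forall>v. 0 \<le> \<alpha> v) \<and> {v. \<alpha> v \<noteq> 0} = \<sigma> \<and> sum \<alpha> \<sigma> = 1}"

lemma open_simplex_pos: "\<alpha> \<in> open_simplex \<sigma> \<Longrightarrow> v \<in> \<sigma> \<Longrightarrow> 0 < \<alpha> v"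
  unfolding open_simplex_def by (auto simp: order_less_le)

lemma open_simplex_zero: "\<alpha> \<in> open_simplex \<sigma> \<Longrightarrow> v \<notin> \<sigma> \<Longrightarrow> \<alpha> v = 0"
  unfolding open_simplex_def by auto

lemma sum_over_vertices:
  assumes "simplicial_complex K" "\<sigma> \<in> K" "{v. \<alpha> v \<noteq> 0} \<subseteq> \<sigma>"
  shows "sum \<alpha> (\<Union>K) = sum \<alpha> \<sigma>"
proof (rule sum.mono_neutral_right)
  show "finite (\<Union>K)" using assms(1) by (auto simp: simplicial_complex_def)
qed (use assms(2,3) in auto)

lemma open_simplex_subset_realization:
  assumes "simplicial_complex K" "\<sigma> \<in> K"
  shows "open_simplex \<sigma> \<subseteq> realization_points K"
proof
  fix \<alpha> assume "\<alpha> \<in> open_simplex \<sigma>"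
  then have \<alpha>: "\<forall>v. 0 \<le> \<alpha> v" "{v. \<alpha> v \<noteq> 0} \<subseteq> \<sigma>" "sum \<alpha> \<sigma> = 1"
    by (simp_all add: open_simplex_def)
  show "\<alpha> \<in> realization_points K"
    unfolding realization_points_def mem_Collect_eq
    using \<alpha> assms(2) sum_over_vertices[OF assms \<alpha>(2)] by metis
qed

lemma realization_points_open_simplex:
  assumes K: "simplicial_complex K" and \<alpha>: "\<alpha> \<in> realization_points K"
  shows "{v. \<alpha> v \<noteq> 0} \<in> K" "\<alpha> \<in> open_simplex {v. \<alpha> v \<noteq> 0}"
proof -
  obtain \<sigma> where \<sigma>: "\<sigma> \<in> K" "{v. \<alpha> v \<noteq> 0} \<subseteq> \<sigma>" "sum \<alpha> (\<Union>K) = 1" "\<forall>v. 0 \<le> \<alpha> v"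
    using \<alpha> unfolding realization_points_def by blast
  have "{v. \<alpha> v \<noteq> 0} \<noteq> {}" using \<sigma>(3) by force
  then show 1: "{v. \<alpha> v \<noteq> 0} \<in> K" using K \<sigma>(1,2) unfolding simplicial_complex_def by blast
  show "\<alpha> \<in> open_simplex {v. \<alpha> v \<noteq> 0}"
    using \<sigma> sum_over_vertices[OF K 1, of \<alpha>] by (simp add: open_simplex_def)
qed

lemma continuous_on_fun_apply: "continuous_on S (\<lambda>x. (x i :: 'b::topological_space))"
  by (rule continuous_on_subset[OF continuous_on_product_coordinates]) auto

text \<open>For a simplex \<open>e\<close> this set is its open star. Positivity of finitely many
  coordinates is an open condition in the product topology.\<close>

lemma open_star_openin:
  assumes "finite e"
  shows "openin (top_of_set (realization_points K)) {\<alpha>\<in>realization_points K. \<forall>v\<in>e. 0 < \<alpha> v}"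
proof -
  have "open (\<Inter>v\<in>e. {\<alpha>::'a\<Rightarrow>real. 0 < \<alpha> v})"
    using assms by (intro open_INT open_Collect_less ballI) (auto intro: continuous_on_fun_apply)
  moreover have "{\<alpha>\<in>realization_points K. \<forall>v\<in>e. 0 < \<alpha> v} =
      realization_points K \<inter> (\<Inter>v\<in>e. {\<alpha>. 0 < \<alpha> v})" by auto
  ultimately show ?thesis by (simp only: openin_open_Int)
qed

text \<open>A point that is positive on \<open>\<sigma>\<close> has a carrier containing
  \<open>\<sigma>\<close>, which maximality forces to be \<open>\<sigma>\<close> itself.\<close>

lemma open_star_maximal:
  assumes K: "simplicial_complex K" and "\<sigma> \<in> K" and max: "\<And>\<tau>. \<tau> \<in> K \<Longrightarrow> \<sigma> \<subseteq> \<tau> \<Longrightarrow> \<tau> = \<sigma>"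
  shows "{\<alpha>\<in>realization_points K. \<forall>v\<in>\<sigma>. 0 < \<alpha> v} = open_simplex \<sigma>"
proof (intro equalityI subsetI)
  fix \<alpha> assume a: "\<alpha> \<in> {\<alpha>\<in>realization_points K. \<forall>v\<in>\<sigma>. 0 < \<alpha> v}"
  then have "\<sigma> \<subseteq> {v. \<alpha> v \<noteq> 0}" by force
  then have "{v. \<alpha> v \<noteq> 0} = \<sigma>" using max realization_points_open_simplex[OF K, of \<alpha>] a by blast
  then show "\<alpha> \<in> open_simplex \<sigma>" using realization_points_open_simplex[OF K, of \<alpha>] a by auto
next
  fix \<alpha> assume "\<alpha> \<in> open_simplex \<sigma>"
  then show "\<alpha> \<in> {\<alpha>\<in>realization_points K. \<forall>v\<in>\<sigma>. 0 < \<alpha> v}"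
    using subsetD[OF open_simplex_subset_realization[OF K assms(2)]] by (simp add: open_simplex_pos)
qed

lemma openin_open_simplex:
  assumes K: "simplicial_complex K" and "\<sigma> \<in> K" and max: "\<And>\<tau>. \<tau> \<in> K \<Longrightarrow> \<sigma> \<subseteq> \<tau> \<Longrightarrow> \<tau> = \<sigma>"
  shows "openin (top_of_set (realization_points K)) (open_simplex \<sigma>)"
proof -
  have "finite \<sigma>" using assms(1,2) by (auto simp: simplicial_complex_def)
  from open_star_openin[OF this, of K] show ?thesis by (simp add: open_star_maximal[OF assms])
qed

text \<open>Sliding \<open>\<alpha>\<close> a little along the segment towards the barycenter of
  \<open>\<sigma>\<close> makes all coordinates on \<open>\<sigma>\<close> positive at once. This
  carries information between a face and the larger simplices around it.\<close>

lemma open_simplex_dense_in_face: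
  assumes K: "simplicial_complex K" and "\<sigma> \<in> K" and \<alpha>: "\<alpha> \<in> open_simplex \<tau>" "\<tau> \<subseteq> \<sigma>" "\<alpha> \<in> W"
    and W: "openin (top_of_set (realization_points K)) W"
  shows "W \<inter> open_simplex \<sigma> \<noteq> {}"
proof -
  have fin: "finite \<sigma>" "\<sigma> \<noteq> {}" using assms(1,2) by (auto simp: simplicial_complex_def)
  \<comment> \<open>The segment from \<open>\<alpha>\<close> at \<open>t = 0\<close> to the
    barycenter of \<open>\<sigma>\<close> at \<open>t = 1\<close>.\<close>
  define \<gamma> where "\<gamma> t v = (1 - t) * \<alpha> v + (if v \<in> \<sigma> then t / card \<sigma> else 0)" for t :: real and v
  obtain O' where O': "open O'" "W = realization_points K \<inter> O'" using W by (auto simp: openin_open)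
  have "continuous_on UNIV \<gamma>"
  proof (intro continuous_on_coordinatewise_then_product)
    show "continuous_on UNIV (\<lambda>t. \<gamma> t v)" for v
      by (cases "v \<in> \<sigma>") (auto simp: \<gamma>_def divide_inverse intro!: continuous_intros)
  qed
  then have "open (\<gamma> -` O')" using O'(1) open_vimage by blast
  moreover have "\<gamma> 0 = \<alpha>" by (auto simp: \<gamma>_def fun_eq_iff)
  ultimately obtain e where e: "e > 0" "ball 0 e \<subseteq> \<gamma> -` O'"
    using O' \<alpha>(3) by (metis IntD2 open_contains_ball vimageI)
  define t where "t = min (e/2) (1/2)"
  have t: "0 < t" "t < 1" "t \<in> ball 0 e" using e(1) by (auto simp: t_def)
  have z: "\<alpha> v = 0" if "v \<notin> \<sigma>" for v
    using open_simplex_zero[OF \<alpha>(1), of v] that \<alpha>(2) by auto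
  have nn: "0 \<le> \<alpha> v" for v using \<alpha>(1) by (auto simp: open_simplex_def)
  have pos: "0 < \<gamma> t v" if "v \<in> \<sigma>" for v
  proof -
    have "0 < t / card \<sigma>" using t(1) fin by (simp add: card_gt_0_iff)
    moreover have "0 \<le> (1-t) * \<alpha> v" using nn t(2) by simp
    ultimately show ?thesis using that by (simp add: \<gamma>_def)
  qed
  have "sum \<alpha> \<sigma> = sum \<alpha> \<tau>"
    using \<alpha>(2) fin open_simplex_zero[OF \<alpha>(1)] by (intro sum.mono_neutral_right) auto
  then have "sum \<alpha> \<sigma> = 1" using \<alpha>(1) by (simp add: open_simplex_def)
  then have sum1: "sum (\<gamma> t) \<sigma> = 1"
    using fin by (simp add: \<gamma>_def sum.distrib flip: sum_distrib_left)
  have "\<gamma> t \<in> open_simplex \<sigma>"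
  proof -
    have out: "\<gamma> t v = 0" if "v \<notin> \<sigma>" for v using z that by (simp add: \<gamma>_def)
    have "0 \<le> \<gamma> t v" for v using pos[of v] out[of v] by (cases "v \<in> \<sigma>") auto
    moreover have "{v. \<gamma> t v \<noteq> 0} = \<sigma>" using pos out by fastforce
    ultimately show ?thesis using sum1 by (simp add: open_simplex_def)
  qed
  moreover have "\<gamma> t \<in> O'" using e t by blast
  ultimately show ?thesis using O'(2) open_simplex_subset_realization[OF K assms(2)] by blast
qed

section \<open>Disc covers\<close>

text \<open>The disc need not be open in \<open>P\<close>: at a circle where more than two half
  discs of a surface meet, it uses two of them. Continuity and injectivity are all that invariance
  of domain asks for, and both survive composition with injective continuous maps.\<close>

definition disc_centered_in :: "'y topology \<Rightarrow> 'y set \<Rightarrow> 'y \<Rightarrow> bool" where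
  "disc_centered_in Y P x \<longleftrightarrow> (\<exists>G (c::real\<times>real) r. 0 < r \<and>
     continuous_map (top_of_set (ball c r)) Y G \<and> inj_on G (ball c r) \<and>
     G ` ball c r \<subseteq> P \<and> G c = x)"

text \<open>By continuity at the center the disc can be shrunk into \<open>W\<close>. This localizes
  discs to open simplices and open stars, where few barycentric coordinates determine a
  point.\<close>

lemma disc_centered_in_Int:
  assumes "disc_centered_in Y P x" and W: "openin Y W" "x \<in> W"
  shows "disc_centered_in Y (P \<inter> W) x"
proof -
  obtain G and c :: "real\<times>real" and r where G: "0 < r" "continuous_map (top_of_set (ball c r)) Y G"
    "inj_on G (ball c r)" "G ` ball c r \<subseteq> P" "G c = x"
    using assms(1) unfolding disc_centered_in_def by blast
  have "openin (top_of_set (ball c r)) {q \<in> ball c r. G q \<in> W}"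
    using openin_continuous_map_preimage[OF G(2) W(1)] by simp
  then have "open {q \<in> ball c r. G q \<in> W}" by (simp add: openin_open_eq)
  then obtain e where e: "e > 0" "ball c e \<subseteq> {q \<in> ball c r. G q \<in> W}"
    using G W(2) by (metis (no_types, lifting) centre_in_ball mem_Collect_eq open_contains_ball)
  have sub: "ball c e \<subseteq> ball c r" using e by auto
  have "continuous_map (top_of_set (ball c e)) Y G"
    using G(2) continuous_map_from_subtopology_mono sub by blast
  moreover have "inj_on G (ball c e)" using G(3) sub inj_on_subset by blast
  moreover have "G ` ball c e \<subseteq> P \<inter> W" using G(4) e(2) sub by blast
  ultimately show ?thesis using e(1) G(5) unfolding disc_centered_in_def by blast
qed

section \<open>Embedded discs and invariance of domain\<close>

lemma disc_centered_in_compose: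
  assumes disc: "disc_centered_in (top_of_set R) P x" and g: "continuous_on P g" "inj_on g P"
  obtains h and c :: "real\<times>real" and r where "0 < r" "continuous_on (ball c r) h" "inj_on h (ball c r)"
    "h ` ball c r \<subseteq> g ` P" "h c = g x"
proof -
  obtain G and c :: "real\<times>real" and r where G: "0 < r" "continuous_map (top_of_set (ball c r)) (top_of_set R) G"
    "inj_on G (ball c r)" "G ` ball c r \<subseteq> P" "G c = x"
    using disc unfolding disc_centered_in_def by blast
  have cG: "continuous_on (ball c r) G"
    using G(2) continuous_map_into_fulltopology by fastforce
  have "continuous_on (ball c r) (g \<circ> G)"
    using cG continuous_on_subset[OF g(1) G(4)] continuous_on_compose by blast
  moreover have "inj_on (g \<circ> G) (ball c r)"
    using G(3) inj_on_subset[OF g(2) G(4)] comp_inj_on by blast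
  moreover have "(g \<circ> G) ` ball c r \<subseteq> g ` P" using G(4) by auto
  ultimately show thesis using that[of r c "g \<circ> G"] G(1,5) by simp
qed

text \<open>Invariance of domain makes the coordinate image of the disc open, although the disc
  itself may not be open in the ambient space.\<close>

lemma disc_centered_in_planar_image_open:
  fixes g :: "_ \<Rightarrow> real \<times> real"
  assumes "disc_centered_in (top_of_set R) P x" and "continuous_on P g" "inj_on g P"
  obtains A where "open A" "g x \<in> A" "A \<subseteq> g ` P"
proof -
  obtain h and c :: "real\<times>real" and r where h: "0 < r" "continuous_on (ball c r) h"
    "inj_on h (ball c r)" "h ` ball c r \<subseteq> g ` P" "h c = g x"
    using disc_centered_in_compose[OF assms] by metis
  have "open (h ` ball c r)" using h by (intro invariance_of_domain) auto
  then show thesis using that[of "h ` ball c r"] h by (metis centre_in_ball imageI)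
qed

lemma disc_centered_in_not_into_real:
  fixes g :: "_ \<Rightarrow> real"
  assumes "disc_centered_in (top_of_set R) P x" and "continuous_on P g" "inj_on g P"
  shows False
proof -
  obtain h and c :: "real\<times>real" and r where h: "0 < r" "continuous_on (ball c r) h"
    "inj_on h (ball c r)" "h ` ball c r \<subseteq> g ` P" "h c = g x"
    using disc_centered_in_compose[OF assms] by metis
  have "DIM(real\<times>real) \<le> DIM(real)" using h by (intro invariance_of_dimension) auto
  then show False by simp
qed

text \<open>A point on the axis could be moved down inside \<open>A\<close>. This rules out both a
  disc centered on the diameter of a half disc and a boundary point that another chart sees as
  interior.\<close>

lemma open_subset_upper_half_plane:
  fixes A :: "(real \<times> real) set"
  assumes "open A" "A \<subseteq> {q. 0 \<le> snd q}" "q \<in> A"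
  shows "0 < snd q"
proof -
  obtain e where e: "e > 0" "ball q e \<subseteq> A" using assms open_contains_ball by blast
  have "dist q (fst q, snd q - e/2) = e/2" using e(1) by (simp add: dist_prod_def dist_real_def)
  then have "(fst q, snd q - e/2) \<in> A" using e by (simp add: subset_iff)
  then show ?thesis using assms(2) e(1) by force
qed

text \<open>For a stratifold, \<open>P i\<close> is the image of the \<open>i\<close>-th surface and \<open>S i\<close> the image of its
  interior.\<close>

locale disc_cover =
  fixes Y :: "'y topology" and n :: nat and P S :: "nat \<Rightarrow> 'y set"
  assumes closed_P: "i < n \<Longrightarrow> closedin Y (P i)"
    and open_S: "i < n \<Longrightarrow> openin Y (S i)"
    and S_ne: "i < n \<Longrightarrow> S i \<noteq> {}"
    and S_subset: "i < n \<Longrightarrow> S i \<subseteq> P i"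
    and S_dense: "\<lbrakk>i < n; openin Y W; W \<inter> P i \<noteq> {}\<rbrakk> \<Longrightarrow> W \<inter> S i \<noteq> {}"
    and S_P_disjoint: "\<lbrakk>i < n; k < n; i \<noteq> k\<rbrakk> \<Longrightarrow> S i \<inter> P k = {}"
    and covers: "topspace Y = (\<Union>i<n. P i)"
    and disc: "\<lbrakk>i < n; x \<in> P i\<rbrakk> \<Longrightarrow> disc_centered_in Y (P i) x"
    and planar: "\<lbrakk>i < n; x \<in> S i\<rbrakk> \<Longrightarrow> \<exists>U (g :: 'y \<Rightarrow> real\<times>real).
      openin Y U \<and> x \<in> U \<and> continuous_map (subtopology Y U) euclidean g \<and> inj_on g U"

text \<open>Every axiom of the locale is invariant under homeomorphism, so a cover of the stratifold
  becomes a cover of the realization, where barycentric coordinates exist.\<close>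

lemma (in disc_cover) homeomorphic_image:
  assumes hk: "homeomorphic_maps Y Z h k"
  shows "disc_cover Z n (\<lambda>i. h ` P i) (\<lambda>i. h ` S i)"
proof -
  have ch: "continuous_map Y Z h" and ck: "continuous_map Z Y k"
    and kh: "\<And>x. x \<in> topspace Y \<Longrightarrow> k (h x) = x" and hk': "\<And>y. y \<in> topspace Z \<Longrightarrow> h (k y) = y"
    using hk by (auto simp: homeomorphic_maps_def)
  have hm: "homeomorphic_map Y Z h" using hk homeomorphic_maps_map by blast
  have PY: "P i \<subseteq> topspace Y" if "i < n" for i using closedin_subset[OF closed_P[OF that]] .
  have SY: "S i \<subseteq> topspace Y" if "i < n" for i using S_subset PY that by blast
  have injh: "inj_on h (topspace Y)" using kh by (rule inj_on_inverseI)
  show ?thesis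
  proof
    show "closedin Z (h ` P i)" if "i < n" for i
      using homeomorphic_imp_closed_map[OF hm] closed_P[OF that] by (simp add: closed_map_def)
    show "openin Z (h ` S i)" if "i < n" for i
      using homeomorphic_imp_open_map[OF hm] open_S[OF that] by (simp add: open_map_def)
    show "h ` S i \<noteq> {}" if "i < n" for i using S_ne[OF that] by simp
    show "h ` S i \<subseteq> h ` P i" if "i < n" for i using S_subset[OF that] by blast
    show "W \<inter> h ` S i \<noteq> {}" if "i < n" "openin Z W" "W \<inter> h ` P i \<noteq> {}" for i W
    proof -
      have "openin Y {x \<in> topspace Y. h x \<in> W}" using openin_continuous_map_preimage[OF ch that(2)] .
      moreover have "{x \<in> topspace Y. h x \<in> W} \<inter> P i \<noteq> {}" using that(3) PY[OF that(1)] by blast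
      ultimately show ?thesis using S_dense[OF that(1)] by blast
    qed
    show "h ` S i \<inter> h ` P k = {}" if "i < n" "k < n" "i \<noteq> k" for i k
      using S_P_disjoint[OF that] inj_on_image_Int[OF injh SY[OF that(1)] PY[OF that(2)]] by simp
    show "topspace Z = (\<Union>i<n. h ` P i)"
      using homeomorphic_imp_surjective_map[OF hm] unfolding covers image_UN by (rule sym)
    show "disc_centered_in Z (h ` P i) x" if i: "i < n" and x: "x \<in> h ` P i" for i x
    proof -
      obtain y where y: "y \<in> P i" "x = h y" using x by blast
      obtain G and c :: "real\<times>real" and r where G: "0 < r" "continuous_map (top_of_set (ball c r)) Y G"
        "inj_on G (ball c r)" "G ` ball c r \<subseteq> P i" "G c = y"
        using disc[OF i y(1)] unfolding disc_centered_in_def by blast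
      have "continuous_map (top_of_set (ball c r)) Z (h \<circ> G)"
        using G(2) ch continuous_map_compose by blast
      moreover have "inj_on (h \<circ> G) (ball c r)"
        using G(3,4) PY[OF i] injh by (meson comp_inj_on inj_on_subset)
      moreover have "(h \<circ> G) ` ball c r \<subseteq> h ` P i" using G(4) by auto
      ultimately show ?thesis using G(1,5) y(2) unfolding disc_centered_in_def by (metis comp_apply)
    qed
    show "\<exists>U (g :: _ \<Rightarrow> real\<times>real).
        openin Z U \<and> x \<in> U \<and> continuous_map (subtopology Z U) euclidean g \<and> inj_on g U"
      if i: "i < n" and x: "x \<in> h ` S i" for i x
    proof -
      obtain y where y: "y \<in> S i" "x = h y" using x by blast
      obtain U and g :: "'y \<Rightarrow> real\<times>real" where U: "openin Y U" "y \<in> U"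
        "continuous_map (subtopology Y U) euclidean g" "inj_on g U"
        using planar[OF i y(1)] by blast
      have UY: "U \<subseteq> topspace Y" using openin_subset[OF U(1)] .
      have "openin Z (h ` U)"
        using homeomorphic_imp_open_map[OF hm] U(1) by (simp add: open_map_def)
      moreover have "continuous_map (subtopology Z (h ` U)) (subtopology Y U) k"
        using ck kh UY by (auto simp: continuous_map_in_subtopology continuous_map_from_subtopology subset_iff)
      then have "continuous_map (subtopology Z (h ` U)) euclidean (g \<circ> k)"
        using U(3) continuous_map_compose by blast
      moreover have "inj_on (g \<circ> k) (h ` U)"
        using U(4) kh UY by (auto simp: inj_on_def subset_iff)
      ultimately show ?thesis using y(2) U(2) by blast
    qed
  qed
qed

section \<open>Triangulated disc covers\<close>

locale triangulated_disc_cover = disc_cover "top_of_set (realization_points K)" n P S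
  for K :: "'v set set" and n P S +
  assumes complex: "simplicial_complex K"
begin

definition maximal_simplex :: "'v set \<Rightarrow> bool" where
  "maximal_simplex \<sigma> \<longleftrightarrow> \<sigma> \<in> K \<and> (\<forall>\<tau>\<in>K. \<sigma> \<subseteq> \<tau> \<longrightarrow> \<tau> = \<sigma>)"

lemma finite_complex: "finite K"
  using complex by (simp add: simplicial_complex_def)

lemma simplexD: "\<sigma> \<in> K \<Longrightarrow> finite \<sigma>" "\<sigma> \<in> K \<Longrightarrow> \<sigma> \<noteq> {}"
  using complex by (auto simp: simplicial_complex_def)

lemma maximal_simplex_openin:
  assumes "maximal_simplex \<sigma>"
  shows "openin (top_of_set (realization_points K)) (open_simplex \<sigma>)"
proof (rule openin_open_simplex[OF complex])
  show "\<sigma> \<in> K" using assms by (simp add: maximal_simplex_def)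
  show "\<tau> = \<sigma>" if "\<tau> \<in> K" "\<sigma> \<subseteq> \<tau>" for \<tau>
    using assms that by (simp add: maximal_simplex_def)
qed

lemma ex_maximal_simplex:
  assumes "\<sigma> \<in> K"
  obtains \<mu> where "maximal_simplex \<mu>" "\<sigma> \<subseteq> \<mu>"
proof -
  obtain \<mu> where "\<mu> \<in> K" "\<sigma> \<subseteq> \<mu>" "\<forall>\<tau>\<in>K. \<mu> \<subseteq> \<tau> \<longrightarrow> \<mu> = \<tau>"
    using finite_has_maximal2[OF finite_complex assms] by blast
  then show thesis using that unfolding maximal_simplex_def by metis
qed

lemma open_simplex_nonempty:
  assumes "\<sigma> \<in> K"
  shows "open_simplex \<sigma> \<noteq> {}"
proof -
  define \<beta> where "\<beta> v = (if v \<in> \<sigma> then 1 / real (card \<sigma>) else 0)" for v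
  have "0 < card \<sigma>" using simplexD[OF assms] by (simp add: card_gt_0_iff)
  then have "\<beta> \<in> open_simplex \<sigma>" by (auto simp: \<beta>_def open_simplex_def)
  then show ?thesis by blast
qed

section \<open>Every maximal simplex is a triangle\<close>

lemma open_simplex_meets:
  assumes "\<sigma> \<in> K"
  obtains i x where "i < n" "x \<in> open_simplex \<sigma>" "x \<in> P i"
proof -
  obtain x where x: "x \<in> open_simplex \<sigma>" using open_simplex_nonempty[OF assms] by blast
  then have "x \<in> realization_points K"
    using open_simplex_subset_realization[OF complex assms] by blast
  then show thesis using that covers x by auto
qed

lemma open_simplex_sum: "\<alpha> \<in> open_simplex \<sigma> \<Longrightarrow> sum \<alpha> \<sigma> = 1"
  by (simp add: open_simplex_def)

text \<open>The open simplex is open in the realization and meets some \<open>P i\<close>, so it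
  contains a disc. With at most two vertices a single barycentric coordinate would embed that disc
  in the line.\<close>

lemma card_maximal_simplex_ge:
  assumes "maximal_simplex \<sigma>"
  shows "3 \<le> card \<sigma>"
proof (rule ccontr)
  assume "\<not> 3 \<le> card \<sigma>"
  moreover have \<sigma>: "\<sigma> \<in> K" using assms by (simp add: maximal_simplex_def)
  moreover have "0 < card \<sigma>" using simplexD[OF \<sigma>] by (simp add: card_gt_0_iff)
  ultimately have "card \<sigma> = 1 \<or> card \<sigma> = 2" by linarith
  \<comment> \<open>A vertex is included as the case \<open>u = v\<close>.\<close>
  then obtain u v where uv: "\<sigma> = {u, v}"
    by (metis card_1_singletonE card_2_iff insert_absorb2)
  obtain i x where i: "i < n" "x \<in> open_simplex \<sigma>" "x \<in> P i" using open_simplex_meets[OF \<sigma>] .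
  have "disc_centered_in (top_of_set (realization_points K)) (P i \<inter> open_simplex \<sigma>) x"
    using disc_centered_in_Int[OF disc[OF i(1,3)] maximal_simplex_openin[OF assms] i(2)] .
  then show False
  proof (rule disc_centered_in_not_into_real[OF _ continuous_on_fun_apply])
    show "inj_on (\<lambda>\<alpha>. \<alpha> u) (P i \<inter> open_simplex \<sigma>)"
  proof (rule inj_onI)
    fix \<alpha> \<beta> assume "\<alpha> \<in> P i \<inter> open_simplex \<sigma>" "\<beta> \<in> P i \<inter> open_simplex \<sigma>"
    then have a: "\<alpha> \<in> open_simplex \<sigma>" and b: "\<beta> \<in> open_simplex \<sigma>" by auto
    assume eq: "\<alpha> u = \<beta> u"
    show "\<alpha> = \<beta>"
    proof
      fix w
      show "\<alpha> w = \<beta> w"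
        using open_simplex_sum[OF a] open_simplex_sum[OF b] open_simplex_zero[OF a, of w]
          open_simplex_zero[OF b, of w] eq by (cases "u = v"; cases "w = u"; cases "w = v") (auto simp: uv)
    qed
  qed
  qed
qed

text \<open>A simplex on four or more vertices contains three-dimensional slices, which the planar
  charts of \<open>S i\<close> would map injectively into the plane.\<close>

lemma card_maximal_simplex_le:
  assumes "maximal_simplex \<sigma>"
  shows "card \<sigma> \<le> 3"
proof (rule ccontr)
  assume "\<not> card \<sigma> \<le> 3"
  have \<sigma>: "\<sigma> \<in> K" using assms by (simp add: maximal_simplex_def)
  note fin = simplexD(1)[OF \<sigma>]
  \<comment> \<open>The simplex may be larger than this. Four of its vertices already give a
    three-parameter family of points.\<close>
  obtain A where A: "A \<subseteq> \<sigma>" "card A = 4"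
    using \<open>\<not> card \<sigma> \<le> 3\<close> obtain_subset_with_card_n[of 4 \<sigma>] by auto
  then have "card A = Suc 3" by simp
  then obtain v0 B where B: "A = insert v0 B" "v0 \<notin> B" "card B = 3"
    by (metis card_eq_SucD)
  then obtain v1 v2 v3 where v: "B = {v1, v2, v3}" "v1 \<noteq> v2" "v1 \<noteq> v3" "v2 \<noteq> v3"
    by (auto simp: card_3_iff)
  have vs: "v0 \<in> \<sigma>" "v1 \<in> \<sigma>" "v2 \<in> \<sigma>" "v3 \<in> \<sigma>" "v0 \<noteq> v1" "v0 \<noteq> v2" "v0 \<noteq> v3"
    using A B v by auto
  obtain i y where i: "i < n" "y \<in> open_simplex \<sigma>" "y \<in> P i" using open_simplex_meets[OF \<sigma>] .
  \<comment> \<open>The point found in \<open>P i\<close> may lie on a circle, where no planar chart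
    is given; density replaces it by a point of \<open>S i\<close>.\<close>
  then have "open_simplex \<sigma> \<inter> S i \<noteq> {}"
    using S_dense[OF i(1) maximal_simplex_openin[OF assms]] by blast
  then obtain x where x: "x \<in> open_simplex \<sigma>" "x \<in> S i" by blast
  obtain U and g :: "('v \<Rightarrow> real) \<Rightarrow> real\<times>real" where U: "openin (top_of_set (realization_points K)) U" "x \<in> U"
    "continuous_map (subtopology (top_of_set (realization_points K)) U) euclidean g" "inj_on g U"
    using planar[OF i(1) x(2)] by blast
  obtain O' where O': "open O'" "U = realization_points K \<inter> O'" using U(1) by (auto simp: openin_open)
  \<comment> \<open>Mass is moved from \<open>v0\<close> to \<open>v1\<close>, \<open>v2\<close>,
    \<open>v3\<close> independently, so the total stays 1 and \<open>F 0 = x\<close>.\<close>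
  define F :: "real \<times> real \<times> real \<Rightarrow> 'v \<Rightarrow> real" where
    "F q w = x w + (if w = v1 then fst q else 0) + (if w = v2 then fst (snd q) else 0)
       + (if w = v3 then snd (snd q) else 0)
       - (if w = v0 then fst q + fst (snd q) + snd (snd q) else 0)" for q w
  have contF': "continuous_on A (\<lambda>q. F q w)" for A w
    unfolding F_def by (cases "w = v0"; cases "w = v1"; cases "w = v2"; cases "w = v3")
      (auto intro!: continuous_intros simp: v vs)
  have contF: "continuous_on A F" for A
    by (intro continuous_on_coordinatewise_then_product contF')
  \<comment> \<open>The parameters that keep the four moved coordinates positive and the point
    inside the chart domain; the other coordinates do not change.\<close>
  define D where "D = F -` O' \<inter> {q. 0 < F q v0} \<inter> {q. 0 < F q v1} \<inter> {q. 0 < F q v2} \<inter> {q. 0 < F q v3}"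
  have "open D" unfolding D_def
    by (intro open_Int open_Collect_less open_vimage contF contF' O'(1)) auto
  have F0: "F 0 = x" by (auto simp: F_def fun_eq_iff)
  have "0 \<in> D" using O' U(2) open_simplex_pos[OF x(1)] vs by (auto simp: D_def F0)
  have FD: "F q \<in> open_simplex \<sigma>" if "q \<in> D" for q
  proof -
    have pos: "0 < F q w" if "w \<in> \<sigma>" for w
    proof (cases "w \<in> {v0,v1,v2,v3}")
      case True then show ?thesis using \<open>q \<in> D\<close> by (auto simp: D_def)
    next
      case False then show ?thesis using open_simplex_pos[OF x(1) that] by (simp add: F_def)
    qed
    have zero: "F q w = 0" if "w \<notin> \<sigma>" for w
      using open_simplex_zero[OF x(1) that] vs that by (auto simp: F_def)
    have nonneg: "0 \<le> F q w" for w using pos[of w] zero[of w] by (cases "w \<in> \<sigma>") auto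
    have supp: "{w. F q w \<noteq> 0} = \<sigma>" using pos zero by fastforce
    have "sum (F q) \<sigma> = sum x \<sigma>"
      unfolding F_def using fin vs by (simp add: sum.distrib sum_subtractf sum.delta)
    then show ?thesis using nonneg supp open_simplex_sum[OF x(1)] by (simp add: open_simplex_def)
  qed
  have FU: "F ` D \<subseteq> U"
    using FD open_simplex_subset_realization[OF complex \<sigma>] O'(2) by (auto simp: D_def)
  have "U \<subseteq> realization_points K" using O'(2) by blast
  then have "continuous_on U g" using U(3) by (simp add: subtopology_subtopology inf_absorb2)
  have "DIM(real\<times>real\<times>real) \<le> DIM(real\<times>real)"
  proof (rule invariance_of_dimension)
    show "continuous_on D (g \<circ> F)"
      using contF continuous_on_subset[OF \<open>continuous_on U g\<close> FU] continuous_on_compose by blast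
    have "inj_on F D"
    proof (rule inj_onI)
      fix q q' assume "F q = F q'"
      then have "F q v1 = F q' v1" "F q v2 = F q' v2" "F q v3 = F q' v3" by auto
      then show "q = q'" using v vs by (auto simp: F_def prod_eq_iff)
    qed
    then show "inj_on (g \<circ> F) D" using inj_on_subset[OF U(4) FU] comp_inj_on by blast
  qed (use \<open>open D\<close> \<open>0 \<in> D\<close> in auto)
  then show False by simp
qed

lemma card_maximal_simplex: "maximal_simplex \<sigma> \<Longrightarrow> card \<sigma> = 3"
  using card_maximal_simplex_ge card_maximal_simplex_le by (simp add: le_antisym)

lemma card_simplex_le:
  assumes "\<sigma> \<in> K" shows "card \<sigma> \<le> 3"
proof -
  obtain \<mu> where \<mu>: "maximal_simplex \<mu>" "\<sigma> \<subseteq> \<mu>" using ex_maximal_simplex[OF assms] .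
  have "\<mu> \<in> K" using \<mu>(1) by (simp add: maximal_simplex_def)
  then show ?thesis using card_mono[OF simplexD(1) \<mu>(2)] card_maximal_simplex[OF \<mu>(1)] by simp
qed

section \<open>Triangles carried by the individual surfaces\<close>

lemma triangle_maximal:
  assumes "\<sigma> \<in> K" "card \<sigma> = 3" shows "maximal_simplex \<sigma>"
  unfolding maximal_simplex_def
proof (intro conjI ballI impI)
  fix \<tau> assume "\<tau> \<in> K" "\<sigma> \<subseteq> \<tau>"
  then show "\<tau> = \<sigma>"
    using card_seteq[of \<tau> \<sigma>] simplexD(1)[of \<tau>] card_simplex_le[of \<tau>] assms(2) by simp
qed (rule assms(1))

text \<open>The open triangle is connected, so it suffices that \<open>P i\<close> cuts out a clopen
  part. Closedness is an axiom of the cover; openness holds because the disc in \<open>P i\<close>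
  at each point has open image in planar coordinates.\<close>

lemma triangle_inside_if_meets:
  assumes \<sigma>: "\<sigma> \<in> K" "card \<sigma> = 3" and i: "i < n" and meets: "open_simplex \<sigma> \<inter> P i \<noteq> {}"
  shows "open_simplex \<sigma> \<subseteq> P i"
proof -
  let ?R = "realization_points K"
  obtain a b c where abc: "\<sigma> = {a, b, c}" "a \<noteq> b" "a \<noteq> c" "b \<noteq> c"
    using \<sigma>(2) by (auto simp: card_3_iff)
  \<comment> \<open>The open triangle in coordinates: \<open>\<pi>\<close> keeps the barycentric
    coordinates at \<open>a\<close> and \<open>b\<close>, and \<open>\<kappa>\<close> restores the
    third one from the sum 1.\<close>
  define E :: "(real \<times> real) set" where "E = {q. 0 < fst q} \<inter> {q. 0 < snd q} \<inter> {q. fst q + snd q < 1}"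
  define \<pi> where "\<pi> \<alpha> = (\<alpha> a, \<alpha> b)" for \<alpha> :: "'v \<Rightarrow> real"
  define \<kappa> where "\<kappa> q w = (if w = a then fst q else if w = b then snd q
      else if w = c then 1 - fst q - snd q else 0)" for q :: "real\<times>real" and w
  have c\<kappa>: "continuous_on A \<kappa>" for A
  proof (intro continuous_on_coordinatewise_then_product)
    fix w show "continuous_on A (\<lambda>q. \<kappa> q w)"
      unfolding \<kappa>_def by (cases "w = a"; cases "w = b"; cases "w = c") (auto intro!: continuous_intros)
  qed
  have "convex E"
    unfolding E_def
  proof (intro convex_Int)
    show "convex {q::real\<times>real. 0 < fst q}" "convex {q::real\<times>real. 0 < snd q}"
      "convex {q::real\<times>real. fst q + snd q < 1}"
      using convex_halfspace_gt[of 0 "(1::real,0::real)"] convex_halfspace_gt[of 0 "(0::real,1::real)"]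
        convex_halfspace_lt[of "(1::real,1::real)" 1]
      by (simp_all add: inner_prod_def)
  qed
  then have conn: "connected E" by (rule convex_connected)
  have \<kappa>E: "\<kappa> q \<in> open_simplex \<sigma>" if "q \<in> E" for q
    using that abc by (auto simp: E_def \<kappa>_def open_simplex_def)
  have \<kappa>R: "\<kappa> ` E \<subseteq> ?R" using \<kappa>E open_simplex_subset_realization[OF complex \<sigma>(1)] by blast
  have \<pi>\<kappa>: "\<pi> (\<kappa> q) = q" for q using abc by (simp add: \<pi>_def \<kappa>_def)
  have \<pi>E: "\<pi> \<alpha> \<in> E" and \<kappa>\<pi>: "\<kappa> (\<pi> \<alpha>) = \<alpha>" if "\<alpha> \<in> open_simplex \<sigma>" for \<alpha>
  proof -
    have s: "\<alpha> a + \<alpha> b + \<alpha> c = 1" using open_simplex_sum[OF that] abc by simp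
    then show "\<pi> \<alpha> \<in> E"
      using open_simplex_pos[OF that, of a] open_simplex_pos[OF that, of b]
        open_simplex_pos[OF that, of c] abc(1) by (simp add: \<pi>_def E_def)
    show "\<kappa> (\<pi> \<alpha>) = \<alpha>" using open_simplex_zero[OF that] abc s
      by (auto simp: \<pi>_def \<kappa>_def fun_eq_iff)
  qed
  define A where "A = E \<inter> \<kappa> -` P i"
  have "closedin (top_of_set E) A"
    unfolding A_def using closed_P[OF i] \<kappa>R by (intro continuous_closedin_preimage_gen[OF c\<kappa>]) auto
  moreover have "openin (top_of_set E) A"
  proof (subst openin_subopen, intro ballI)
    fix q assume "q \<in> A"
    then have q: "q \<in> E" "\<kappa> q \<in> P i" by (auto simp: A_def)
    have "disc_centered_in (top_of_set ?R) (P i \<inter> open_simplex \<sigma>) (\<kappa> q)"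
      using disc_centered_in_Int[OF disc[OF i q(2)] maximal_simplex_openin[OF triangle_maximal[OF \<sigma>]] \<kappa>E[OF q(1)]] .
    moreover have "continuous_on (P i \<inter> open_simplex \<sigma>) \<pi>"
      unfolding \<pi>_def by (intro continuous_intros continuous_on_fun_apply)
    moreover have "inj_on \<pi> (P i \<inter> open_simplex \<sigma>)"
      using \<kappa>\<pi> by (intro inj_on_inverseI[of _ \<kappa>]) auto
    ultimately obtain B where B: "open B" "\<pi> (\<kappa> q) \<in> B" "B \<subseteq> \<pi> ` (P i \<inter> open_simplex \<sigma>)"
      using disc_centered_in_planar_image_open by metis
    have "B \<subseteq> A" using B(3) \<kappa>\<pi> \<pi>E by (auto simp: A_def)
    moreover have "openin (top_of_set E) B"
      using B(1) \<open>B \<subseteq> A\<close> by (intro open_subset) (auto simp: A_def)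
    ultimately show "\<exists>T. openin (top_of_set E) T \<and> q \<in> T \<and> T \<subseteq> A" using B(2) \<pi>\<kappa> by auto
  qed
  ultimately have "A = {} \<or> A = E" using conn by (meson connected_clopen)
  moreover have "A \<noteq> {}"
  proof -
    obtain \<alpha> where "\<alpha> \<in> open_simplex \<sigma>" "\<alpha> \<in> P i" using meets by blast
    then have "\<pi> \<alpha> \<in> A" using \<pi>E \<kappa>\<pi> by (simp add: A_def)
    then show ?thesis by blast
  qed
  ultimately have "A = E" by blast
  show ?thesis
  proof
    fix \<alpha> assume "\<alpha> \<in> open_simplex \<sigma>"
    then show "\<alpha> \<in> P i" using \<pi>E[of \<alpha>] \<kappa>\<pi>[of \<alpha>] \<open>A = E\<close> unfolding A_def by (metis IntD2 vimageD)
  qed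
qed

definition sheet_triangles :: "nat \<Rightarrow> 'v set set" where
  "sheet_triangles i = {\<sigma>\<in>K. card \<sigma> = 3 \<and> open_simplex \<sigma> \<subseteq> P i}"

text \<open>A point of \<open>S i\<close> may lie on an edge or a vertex, but \<open>S i\<close> is
  open and therefore reaches into the interior of a maximal simplex above its carrier.\<close>

lemma sheet_triangles_nonempty:
  assumes i: "i < n" shows "sheet_triangles i \<noteq> {}"
proof -
  obtain x where x: "x \<in> S i" using S_ne[OF i] by blast
  then have "x \<in> realization_points K" using openin_subset[OF open_S[OF i]] by auto
  note r = realization_points_open_simplex[OF complex this]
  obtain \<mu> where \<mu>: "maximal_simplex \<mu>" "{v. x v \<noteq> 0} \<subseteq> \<mu>" using ex_maximal_simplex[OF r(1)] .
  have \<mu>K: "\<mu> \<in> K" using \<mu>(1) by (simp add: maximal_simplex_def)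
  have "S i \<inter> open_simplex \<mu> \<noteq> {}"
    using open_simplex_dense_in_face[OF complex \<mu>K r(2) \<mu>(2) x open_S[OF i]] .
  then have "open_simplex \<mu> \<inter> P i \<noteq> {}" using S_subset[OF i] by blast
  then have "\<mu> \<in> sheet_triangles i"
    using triangle_inside_if_meets[OF \<mu>K _ i] card_maximal_simplex[OF \<mu>(1)] \<mu>K
    by (simp add: sheet_triangles_def)
  then show ?thesis by blast
qed

text \<open>An open triangle inside \<open>P i\<close> is open in the realization, so by density it
  contains a point of \<open>S i\<close>, and that point is outside \<open>P k\<close>.\<close>

lemma sheet_triangles_disjoint:
  assumes "i < n" "k < n" "i \<noteq> k" shows "sheet_triangles i \<inter> sheet_triangles k = {}"
proof (rule ccontr)
  assume "\<not> ?thesis"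
  then obtain \<sigma> where \<sigma>: "\<sigma> \<in> K" "card \<sigma> = 3" "open_simplex \<sigma> \<subseteq> P i" "open_simplex \<sigma> \<subseteq> P k"
    by (auto simp: sheet_triangles_def)
  have "open_simplex \<sigma> \<inter> P i \<noteq> {}" using open_simplex_nonempty[OF \<sigma>(1)] \<sigma>(3) by blast
  then have "open_simplex \<sigma> \<inter> S i \<noteq> {}"
    using S_dense[OF assms(1) maximal_simplex_openin[OF triangle_maximal[OF \<sigma>(1,2)]]] by blast
  then show False using \<sigma>(4) S_P_disjoint[OF assms] by blast
qed

text \<open>If \<open>\<tau>\<close> were the only such triangle at \<open>e\<close>, then near the midpoint of \<open>e\<close> the set \<open>P i\<close> would
  be a half disc, which contains no disc centered on its diameter.\<close>

lemma sheet_triangles_edge: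
  assumes i: "i < n" and \<tau>: "\<tau> \<in> sheet_triangles i" and e: "e \<subset> \<tau>" "card e = 2"
  shows "\<exists>\<tau>'\<in>sheet_triangles i. \<tau>' \<noteq> \<tau> \<and> e \<subset> \<tau>'"
proof (rule ccontr)
  assume no: "\<not> ?thesis"
  let ?R = "realization_points K"
  have \<tau>K: "\<tau> \<in> K" "card \<tau> = 3" "open_simplex \<tau> \<subseteq> P i" using \<tau> by (auto simp: sheet_triangles_def)
  obtain a b where ab: "e = {a, b}" "a \<noteq> b" using e(2) by (auto simp: card_2_iff)
  have "card (\<tau> - e) = 1" using e \<tau>K simplexD(1)[OF \<tau>K(1)]
    by (subst card_Diff_subset) (auto intro: finite_subset)
  then obtain c where c: "\<tau> - e = {c}" using card_1_singletonE by blast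
  then have \<tau>_eq: "\<tau> = {a, b, c}" "c \<noteq> a" "c \<noteq> b" using e(1) ab by auto
  have eK: "e \<in> K" using complex \<tau>K(1) e ab unfolding simplicial_complex_def by blast
  obtain x where x: "x \<in> open_simplex e" using open_simplex_nonempty[OF eK] by blast
  have xR: "x \<in> ?R" using x open_simplex_subset_realization[OF complex eK] by blast
  \<comment> \<open>The edge is in the closure of the open triangle \<open>\<tau>\<close>, and
    \<open>P i\<close> is closed.\<close>
  have xP: "x \<in> P i"
  proof (rule ccontr)
    assume "x \<notin> P i"
    then have "x \<in> ?R - P i" using xR by blast
    moreover have "openin (top_of_set ?R) (?R - P i)" using closed_P[OF i] by (simp add: closedin_def)
    ultimately have "(?R - P i) \<inter> open_simplex \<tau> \<noteq> {}"
      using open_simplex_dense_in_face[OF complex \<tau>K(1) x] e(1) by blast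
    then show False using \<tau>K(3) by blast
  qed
  let ?W = "{\<alpha>\<in>?R. \<forall>v\<in>e. 0 < \<alpha> v}"
  have D: "disc_centered_in (top_of_set ?R) (P i \<inter> ?W) x"
    using xR open_simplex_pos[OF x]
    by (intro disc_centered_in_Int[OF disc[OF i xP]] open_star_openin simplexD(1)[OF eK]) auto
  \<comment> \<open>In the open star of \<open>e\<close> every carrier contains \<open>e\<close>. A
    carrier other than \<open>e\<close> is a triangle that meets \<open>P i\<close>, hence lies in
    it, and by \<open>no\<close> it is \<open>\<tau>\<close>.\<close>
  have sub: "\<alpha> \<in> open_simplex e \<or> \<alpha> \<in> open_simplex \<tau>" if "\<alpha> \<in> P i \<inter> ?W" for \<alpha>
  proof -
    have "\<alpha> \<in> ?R" using that by blast
    then obtain s where r: "s \<in> K" "\<alpha> \<in> open_simplex s"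
      using realization_points_open_simplex[OF complex] by blast
    have es: "e \<subseteq> s" using that open_simplex_zero[OF r(2)] by force
    show ?thesis
    proof (cases "s = e")
      case False
      then have "e \<subset> s" using es by blast
      then have "2 < card s" using psubset_card_mono[OF simplexD(1)[OF r(1)]] e(2) by metis
      then have "card s = 3" using card_simplex_le[OF r(1)] by linarith
      moreover have "open_simplex s \<inter> P i \<noteq> {}" using r(2) that by blast
      ultimately have "s \<in> sheet_triangles i"
        using triangle_inside_if_meets[OF r(1) _ i] r(1) by (simp add: sheet_triangles_def)
      then have "s = \<tau>" using no \<open>e \<subset> s\<close> by blast
      then show ?thesis using r(2) by simp
    next
      case True
      then show ?thesis using r(2) by simp
    qed
  qed
  \<comment> \<open>The coordinate at \<open>a\<close> runs along the edge, and the one at the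
    opposite vertex \<open>c\<close> measures the distance from it, vanishing exactly on
    \<open>e\<close>.\<close>
  define \<pi> where "\<pi> \<alpha> = (\<alpha> a, \<alpha> c)" for \<alpha> :: "'v \<Rightarrow> real"
  have nn: "0 \<le> \<alpha> c" and sum1: "\<alpha> a + \<alpha> b + \<alpha> c = 1" and out: "\<And>w. w \<notin> {a,b,c} \<Longrightarrow> \<alpha> w = 0"
    if "\<alpha> \<in> P i \<inter> ?W" for \<alpha>
  proof -
    have "0 \<le> \<alpha> c \<and> \<alpha> a + \<alpha> b + \<alpha> c = 1 \<and> (\<forall>w. w \<notin> {a,b,c} \<longrightarrow> \<alpha> w = 0)"
      using sub[OF that]
    proof
      assume m: "\<alpha> \<in> open_simplex e"
      then show ?thesis
        using open_simplex_zero[OF m] open_simplex_sum[OF m] ab \<tau>_eq by simp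
    next
      assume m: "\<alpha> \<in> open_simplex \<tau>"
      then show ?thesis
        using open_simplex_zero[OF m] open_simplex_sum[OF m] open_simplex_pos[OF m, of c] ab \<tau>_eq by simp
    qed
    then show "0 \<le> \<alpha> c" "\<alpha> a + \<alpha> b + \<alpha> c = 1" "\<And>w. w \<notin> {a,b,c} \<Longrightarrow> \<alpha> w = 0" by blast+
  qed
  have cont: "continuous_on (P i \<inter> ?W) \<pi>"
    unfolding \<pi>_def by (intro continuous_intros continuous_on_fun_apply)
  have inj: "inj_on \<pi> (P i \<inter> ?W)"
  proof (rule inj_onI)
    fix \<alpha> \<beta> assume a: "\<alpha> \<in> P i \<inter> ?W" and b: "\<beta> \<in> P i \<inter> ?W" and "\<pi> \<alpha> = \<pi> \<beta>"
    then have eq: "\<alpha> a = \<beta> a" "\<alpha> c = \<beta> c" by (auto simp: \<pi>_def)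
    then have "\<alpha> b = \<beta> b" using sum1[OF a] sum1[OF b] by linarith
    then show "\<alpha> = \<beta>" using out[OF a] out[OF b] eq by (metis ext empty_iff insert_iff)
  qed
  obtain A where A: "open A" "\<pi> x \<in> A" "A \<subseteq> \<pi> ` (P i \<inter> ?W)"
    using disc_centered_in_planar_image_open[OF D cont inj] .
  have "\<pi> ` (P i \<inter> ?W) \<subseteq> {q. 0 \<le> snd q}" using nn by (auto simp: \<pi>_def)
  then have "0 < snd (\<pi> x)" using open_subset_upper_half_plane[OF A(1) _ A(2)] A(3) by blast
  moreover have "x c = 0" using open_simplex_zero[OF x] ab \<tau>_eq by auto
  ultimately show False by (simp add: \<pi>_def)
qed

theorem m2_ge:
  assumes "discrete_morse K f" shows "n \<le> m2 K f"
proof (rule m2_ge_disjoint_doubly_covered_families[where T = sheet_triangles])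
  show "\<exists>\<tau>'\<in>sheet_triangles i. \<tau>' \<noteq> \<tau> \<and> e \<subset> \<tau>'"
    if "i < n" "\<tau> \<in> sheet_triangles i" "e \<subset> \<tau>" "card e = 2" for i \<tau> e
    using sheet_triangles_edge[OF that] .
  show "sheet_triangles i \<inter> sheet_triangles k = {}" if "i < n" "k < n" "i \<noteq> k" for i k
    using sheet_triangles_disjoint[OF that] .
qed (use finite_complex assms card_simplex_le sheet_triangles_nonempty in
    \<open>auto simp: sheet_triangles_def\<close>)

end

section \<open>Surfaces with boundary\<close>

text \<open>The inverse \<open>k\<close> is part of the data because discs in the surface are built
  as images of planar sets under \<open>k\<close>.\<close>

definition half_chart ::
  "'a topology \<Rightarrow> 'a set \<Rightarrow> (real \<times> real) set \<Rightarrow> ('a \<Rightarrow> real \<times> real) \<Rightarrow> (real \<times> real \<Rightarrow> 'a) \<Rightarrow> bool" where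
  "half_chart M U V g k \<longleftrightarrow> openin M U \<and> openin (top_of_set {q. 0 \<le> snd q}) V \<and>
     homeomorphic_maps (subtopology M U) (top_of_set V) g k"

lemma half_chart_iff:
  "(\<exists>k. half_chart M U V g k) \<longleftrightarrow>
     openin M U \<and> openin half_plane V \<and> homeomorphic_map (subtopology M U) (subtopology half_plane V) g"
proof -
  have "subtopology half_plane V = top_of_set V" if "openin half_plane V"
    using openin_subset[OF that] by (simp add: half_plane_def subtopology_subtopology inf_absorb2)
  then show ?thesis
    unfolding half_chart_def homeomorphic_map_maps by (metis half_plane_def)
qed

lemma half_chartD:
  assumes "half_chart M U V g k"
  shows "openin M U" "U \<subseteq> topspace M" "V \<subseteq> {q. 0 \<le> snd q}"
    "\<And>x. x \<in> U \<Longrightarrow> g x \<in> V" "\<And>q. q \<in> V \<Longrightarrow> k q \<in> U" "\<And>x. x \<in> U \<Longrightarrow> k (g x) = x" "\<And>q. q \<in> V \<Longrightarrow> g (k q) = q"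
    "continuous_map (subtopology M U) euclidean g" "continuous_map (top_of_set V) M k"
proof -
  show U: "openin M U" using assms by (simp add: half_chart_def)
  show UM: "U \<subseteq> topspace M" using openin_subset[OF U] .
  show "V \<subseteq> {q. 0 \<le> snd q}" 
    using assms openin_subset[of "top_of_set {q. 0 \<le> snd q}" V] by (simp add: half_chart_def)
  have hm: "homeomorphic_maps (subtopology M U) (top_of_set V) g k" using assms by (simp add: half_chart_def)
  have tU: "topspace (subtopology M U) = U" using UM by auto
  have g: "continuous_map (subtopology M U) (top_of_set V) g" and k: "continuous_map (top_of_set V) (subtopology M U) k"
    using hm by (auto simp: homeomorphic_maps_def)
  show "g x \<in> V" if "x \<in> U" for x
    using continuous_map_image_subset_topspace[OF g] that unfolding tU by auto
  show "k q \<in> U" if "q \<in> V" for q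
    using continuous_map_image_subset_topspace[OF k] that unfolding tU by auto
  show "k (g x) = x" if "x \<in> U" for x using hm that unfolding homeomorphic_maps_def tU by blast
  show "g (k q) = q" if "q \<in> V" for q using hm that by (auto simp: homeomorphic_maps_def)
  show "continuous_map (subtopology M U) euclidean g" using g continuous_map_into_fulltopology by blast
  show "continuous_map (top_of_set V) M k" using k continuous_map_into_fulltopology by blast
qed

lemma half_chart_open:
  assumes "half_chart M U V g k"
  obtains T where "open T" "V = {q. 0 \<le> snd q} \<inter> T"
  using assms that by (auto simp: half_chart_def openin_open)

lemma half_chart_open_interior:
  assumes "half_chart M U V g k"
  shows "open (V \<inter> {q. 0 < snd q})"
proof -
  obtain T where T: "open T" "V = {q. 0 \<le> snd q} \<inter> T" using half_chart_open[OF assms] .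
  have "V \<inter> {q. 0 < snd q} = T \<inter> {q. 0 < snd q}" using T(2) by auto
  moreover have "open (T \<inter> {q::real\<times>real. 0 < snd q})"
    by (intro open_Int T(1) open_Collect_less continuous_intros)
  ultimately show ?thesis by simp
qed

lemma half_chart_restrict:
  assumes ch: "half_chart M U V g k" and W: "openin M W"
  shows "half_chart M (U \<inter> W) (g ` (U \<inter> W)) g k"
proof -
  note D = half_chartD[OF ch]
  have hm: "homeomorphic_maps (subtopology M U) (top_of_set V) g k" using ch by (simp add: half_chart_def)
  then have "open_map (subtopology M U) (top_of_set V) g"
    using homeomorphic_imp_open_map homeomorphic_maps_map by blast
  moreover have "openin (subtopology M U) (U \<inter> W)"
    using W by (simp add: openin_subtopology_Int2)
  ultimately have "openin (top_of_set V) (g ` (U \<inter> W))" by (simp add: open_map_def)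
  moreover have "openin (top_of_set {q. 0 \<le> snd q}) V" using ch by (simp add: half_chart_def)
  ultimately have "openin (top_of_set {q. 0 \<le> snd q}) (g ` (U \<inter> W))" using openin_trans by blast
  moreover have "openin M (U \<inter> W)" using D(1) W by (rule openin_Int)
  moreover have "homeomorphic_maps (subtopology M (U \<inter> W)) (top_of_set (g ` (U \<inter> W))) g k"
    unfolding homeomorphic_maps_def
  proof (intro conjI ballI)
    show "continuous_map (subtopology M (U \<inter> W)) (top_of_set (g ` (U \<inter> W))) g"
      using continuous_map_from_subtopology_mono[OF D(8), of "U \<inter> W"]
      by (auto simp: continuous_map_in_subtopology)
    have "g ` (U \<inter> W) \<subseteq> V" using D(4) by blast
    then show "continuous_map (top_of_set (g ` (U \<inter> W))) (subtopology M (U \<inter> W)) k"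
      using continuous_map_from_subtopology_mono[OF D(9)] D(6)
      by (auto simp: continuous_map_in_subtopology)
  qed (use D in auto)
  ultimately show ?thesis by (simp add: half_chart_def)
qed

text \<open>The transition map \<open>g' \<circ> k\<close> is injective and continuous on the part
  of the chart image off the axis, which is open in the plane. Its image is then open and contained
  in the half plane, so it avoids the axis.\<close>

lemma half_chart_interior_invariant:
  assumes ch: "half_chart M U V g k" and ch': "half_chart M U' V' g' k'"
    and x: "x \<in> U" "x \<in> U'" "0 < snd (g x)"
  shows "0 < snd (g' x)"
proof -
  note r = half_chart_restrict[OF ch half_chartD(1)[OF ch']]
  note D = half_chartD[OF r] and D' = half_chartD[OF ch']
  let ?V = "g ` (U \<inter> U') \<inter> {q. 0 < snd q}"
  have kU: "k q \<in> U'" if "q \<in> ?V" for q using D(5)[of q] that by blast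
  have "continuous_map (top_of_set ?V) (subtopology M U') k"
    using continuous_map_from_subtopology_mono[OF D(9), of ?V] kU
    by (auto simp: continuous_map_in_subtopology)
  from continuous_map_compose[OF this D'(8)]
  have cont: "continuous_on ?V (g' \<circ> k)" by simp
  have inj: "inj_on (g' \<circ> k) ?V"
  proof (rule inj_onI)
    fix q q' assume a: "q \<in> ?V" "q' \<in> ?V" and "(g' \<circ> k) q = (g' \<circ> k) q'"
    then have "k' (g' (k q)) = k' (g' (k q'))" by (simp only: comp_apply)
    then have "k q = k q'" by (simp only: D'(6)[OF kU[OF a(1)]] D'(6)[OF kU[OF a(2)]])
    then show "q = q'" using D(7)[OF IntD1[OF a(1)]] D(7)[OF IntD1[OF a(2)]] by metis
  qed
  have "open ((g' \<circ> k) ` ?V)"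
    by (rule invariance_of_domain[OF cont half_chart_open_interior[OF r] inj])
  moreover have "(g' \<circ> k) ` ?V \<subseteq> {q. 0 \<le> snd q}"
  proof (rule image_subsetI)
    fix q assume "q \<in> ?V"
    then show "(g' \<circ> k) q \<in> {q. 0 \<le> snd q}" using subsetD[OF D'(3) D'(4)[OF kU]] by simp
  qed
  moreover have "g' x \<in> (g' \<circ> k) ` ?V"
    using x D(6)[of x] by (intro image_eqI[of _ _ "g x"]) auto
  ultimately show ?thesis by (rule open_subset_upper_half_plane)
qed

text \<open>\<open>surf_boundary\<close> asks for some chart that sends the point to the axis; by
  chart invariance any chart at the point decides membership.\<close>

lemma surf_boundary_half_chart_iff:
  assumes ch: "half_chart M U V g k" and x: "x \<in> U"
  shows "x \<in> surf_boundary M \<longleftrightarrow> snd (g x) = 0"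
proof
  assume "snd (g x) = 0"
  then show "x \<in> surf_boundary M"
    unfolding surf_boundary_def using half_chartD(2)[OF ch] x half_chart_iff[of M U V g] ch by blast
next
  assume "x \<in> surf_boundary M"
  then obtain U' V' g' where "openin M U'" "x \<in> U'" "openin half_plane V'"
    "homeomorphic_map (subtopology M U') (subtopology half_plane V') g'" and s: "snd (g' x) = 0"
    unfolding surf_boundary_def by blast
  then obtain k' where ch': "half_chart M U' V' g' k'" using half_chart_iff[of M U' V' g'] by blast
  have "\<not> 0 < snd (g x)"
    using half_chart_interior_invariant[OF ch ch' x \<open>x \<in> U'\<close>] s by linarith
  moreover have "0 \<le> snd (g x)" using half_chartD(3,4)[OF ch] x by blast
  ultimately show "snd (g x) = 0" by simp
qed

lemma surf_boundary_subset: "surf_boundary M \<subseteq> topspace M"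
  by (auto simp: surf_boundary_def)

lemma surface_half_chart:
  assumes "surface_with_boundary M" "openin M W" "x \<in> W"
  obtains U V g k where "half_chart M U V g k" "x \<in> U" "U \<subseteq> W"
proof -
  have "x \<in> topspace M" using openin_subset[OF assms(2)] assms(3) by blast
  then obtain U V g where "openin M U \<and> openin half_plane V \<and>
      homeomorphic_map (subtopology M U) (subtopology half_plane V) g" "x \<in> U"
    using assms(1) unfolding surface_with_boundary_def by blast
  then obtain k where "half_chart M U V g k" "x \<in> U" using half_chart_iff[of M U V g] by blast
  then show thesis using half_chart_restrict[OF _ assms(2)] that assms(3) by (metis Int_iff Int_lower2)
qed

lemma surface_interior_open:
  assumes "surface_with_boundary M"
  shows "openin M (topspace M - surf_boundary M)"
proof (subst openin_subopen, intro ballI)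
  fix x assume x: "x \<in> topspace M - surf_boundary M"
  obtain U V g k where ch: "half_chart M U V g k" "x \<in> U" "U \<subseteq> topspace M"
    using surface_half_chart[OF assms openin_topspace DiffD1[OF x]] .
  note D = half_chartD[OF ch(1)]
  let ?T = "{y \<in> topspace (subtopology M U). g y \<in> {q. 0 < snd q}}"
  have "openin (subtopology M U) ?T"
    by (rule openin_continuous_map_preimage[OF D(8)])
      (auto intro!: open_Collect_less continuous_intros simp flip: open_openin)
  then have "openin M ?T" using D(1) openin_trans_full by blast
  moreover have "x \<in> ?T"
    using surf_boundary_half_chart_iff[OF ch(1,2)] D(3) D(4)[OF ch(2)] x ch(2) by force
  moreover have "?T \<subseteq> topspace M - surf_boundary M"
    using surf_boundary_half_chart_iff[OF ch(1)] by auto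
  ultimately show "\<exists>T. openin M T \<and> x \<in> T \<and> T \<subseteq> topspace M - surf_boundary M" by blast
qed

text \<open>In a chart at \<open>x\<close>, moving up by half the radius of a ball stays in the
  relatively open set \<open>V\<close> and leaves the axis.\<close>

lemma surface_interior_dense:
  assumes "surface_with_boundary M" "openin M W" "x \<in> W"
  shows "W \<inter> (topspace M - surf_boundary M) \<noteq> {}"
proof -
  obtain U V g k where ch: "half_chart M U V g k" "x \<in> U" "U \<subseteq> W"
    using surface_half_chart[OF assms] .
  note D = half_chartD[OF ch(1)]
  obtain T where T: "open T" "V = {q. 0 \<le> snd q} \<inter> T" using half_chart_open[OF ch(1)] .
  have gx: "g x \<in> T" "0 \<le> snd (g x)" using D(4)[OF ch(2)] T by auto
  then obtain e where e: "e > 0" "ball (g x) e \<subseteq> T" using T(1) open_contains_ball by blast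
  let ?q = "(fst (g x), snd (g x) + e/2)"
  have "dist (g x) ?q = e/2" using e(1) by (simp add: dist_prod_def dist_real_def)
  then have "?q \<in> T" using e by (simp add: subset_iff)
  then have q: "?q \<in> V" using T(2) gx e(1) by simp
  have "k ?q \<notin> surf_boundary M"
    using surf_boundary_half_chart_iff[OF ch(1) D(5)[OF q]] D(7)[OF q] gx e(1) by simp
  then show ?thesis using D(5)[OF q] ch(3) D(2) by blast
qed

text \<open>A ball in the chart image that avoids the axis pulls back to interior points, on which
  \<open>p\<close> is injective.\<close>

lemma disc_centered_in_surface_interior:
  assumes M: "surface_with_boundary M" and p: "continuous_map M X p"
    and inj: "inj_on p (topspace M - surf_boundary M)" and y: "y \<in> topspace M - surf_boundary M"
  shows "disc_centered_in X (p ` topspace M) (p y)"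
proof -
  obtain U V g k where ch: "half_chart M U V g k" "y \<in> U" "U \<subseteq> topspace M"
    using surface_half_chart[OF M openin_topspace DiffD1[OF y]] .
  note D = half_chartD[OF ch(1)]
  have gy: "g y \<in> V \<inter> {q. 0 < snd q}"
    using surf_boundary_half_chart_iff[OF ch(1,2)] D(3) D(4)[OF ch(2)] y by force
  then obtain e where e: "e > 0" "ball (g y) e \<subseteq> V \<inter> {q. 0 < snd q}"
    using half_chart_open_interior[OF ch(1)] open_contains_ball by blast
  have int: "k q \<in> topspace M - surf_boundary M" if "q \<in> ball (g y) e" for q
  proof -
    have "q \<in> V" "0 < snd q" using that e(2) by auto
    then show ?thesis
      using surf_boundary_half_chart_iff[OF ch(1) D(5)] D(5)[of q] D(7)[of q] D(2) by auto
  qed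
  have "continuous_map (top_of_set (ball (g y) e)) M k"
    using continuous_map_from_subtopology_mono[OF D(9)] e(2) by blast
  then have "continuous_map (top_of_set (ball (g y) e)) X (p \<circ> k)"
    using p continuous_map_compose by blast
  moreover have "inj_on k (ball (g y) e)"
    using D(7) e(2) by (intro inj_on_inverseI[of _ g]) auto
  then have "inj_on (p \<circ> k) (ball (g y) e)"
    using int by (intro comp_inj_on inj_on_subset[OF inj]) auto
  moreover have "(p \<circ> k) ` ball (g y) e \<subseteq> p ` topspace M" using int by auto
  ultimately show ?thesis
    using e(1) D(6)[OF ch(2)] unfolding disc_centered_in_def by (metis comp_apply)
qed

section \<open>Coverings of the circle\<close>

text \<open>Being a singleton fibre is a locally constant property of the base point, hence constant
  on a connected base. Comparing singletons avoids counting sheets.\<close>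

lemma covering_map_unique_fibre:
  assumes cov: "covering_map E B p" and conn: "connected_space B"
    and b: "b \<in> topspace B" "b' \<in> topspace B" and uniq: "\<exists>!x. x \<in> topspace E \<and> p x = b"
  shows "\<exists>!x. x \<in> topspace E \<and> p x = b'"
proof -
  define u where "u b \<longleftrightarrow> (\<exists>!x. x \<in> topspace E \<and> p x = b)" for b
  have loc: "\<exists>U. openin B U \<and> c \<in> U \<and> (\<forall>d\<in>U. u d = u c)" if c: "c \<in> topspace B" for c
  proof -
    obtain U \<V> where U: "openin B U" "c \<in> U" and \<V>: "\<Union>\<V> = {x\<in>topspace E. p x \<in> U}" "pairwise disjnt \<V>"
      and h: "\<And>V. V\<in>\<V> \<Longrightarrow> openin E V \<and> homeomorphic_map (subtopology E V) (subtopology B U) p"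
      using cov c unfolding covering_map_def by meson
    have sheet: "\<exists>!x. x \<in> V \<and> p x = d" if V: "V \<in> \<V>" and d: "d \<in> U" for V d
    proof -
      have tV: "topspace (subtopology E V) = V" and tU: "topspace (subtopology B U) = U"
        using h[OF V] U(1) openin_subset by fastforce+
      have "p ` V = U" "inj_on p V"
        using homeomorphic_imp_surjective_map[of "subtopology E V" "subtopology B U" p]
          homeomorphic_imp_injective_map[of "subtopology E V" "subtopology B U" p] h[OF V]
        unfolding tV tU by auto
      then show ?thesis using d by (auto simp: inj_on_def)
    qed
    \<comment> \<open>Each sheet over \<open>U\<close> contains exactly one point above
      \<open>d\<close>, so the fibre is a singleton iff there is exactly one sheet, a condition that
      does not mention \<open>d\<close>.\<close>
    have eq: "u d \<longleftrightarrow> (\<exists>!V. V \<in> \<V>)" if d: "d \<in> U" for d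
    proof
      assume "u d"
      then obtain x where x: "x \<in> topspace E" "p x = d" "\<And>x'. x' \<in> topspace E \<Longrightarrow> p x' = d \<Longrightarrow> x' = x" unfolding u_def by blast
      have "x \<in> \<Union>\<V>" using x(1,2) d \<V>(1) by blast
      then obtain V where V: "V \<in> \<V>" "x \<in> V" by blast
      have "V' = V" if V': "V' \<in> \<V>" for V'
      proof -
        obtain x' where x': "x' \<in> V'" "p x' = d" using sheet[OF V' d] by blast
        then have "x' \<in> topspace E" using V' \<V>(1) by blast
        then have "x \<in> V'" using x(3) x' by blast
        then show ?thesis using \<V>(2) V V' unfolding pairwise_def disjnt_def by blast
      qed
      then show "\<exists>!V. V \<in> \<V>" using V(1) by blast
    next
      assume "\<exists>!V. V \<in> \<V>"
      then obtain V where V: "V \<in> \<V>" "\<And>V'. V' \<in> \<V> \<Longrightarrow> V' = V" by blast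
      obtain x where x: "x \<in> V" "p x = d" "\<And>x'. x' \<in> V \<Longrightarrow> p x' = d \<Longrightarrow> x' = x" using sheet[OF V(1) d] by blast
      have "x' = x" if "x' \<in> topspace E" "p x' = d" for x'
      proof -
        have "x' \<in> \<Union>\<V>" using that d \<V>(1) by blast
        then have "x' \<in> V" using V(2) by blast
        then show ?thesis using x(3) that(2) by blast
      qed
      moreover have "x \<in> topspace E" using x(1) V(1) \<V>(1) by blast
      ultimately show "u d" unfolding u_def using x(2) by blast
    qed
    have "u d = u c" if "d \<in> U" for d unfolding eq[OF that] eq[OF U(2)] ..
    then show ?thesis using U by blast
  qed
  let ?Q = "{c \<in> topspace B. u c}"
  have "openin B ?Q"
  proof (subst openin_subopen, intro ballI)
    fix c assume c: "c \<in> ?Q"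
    then obtain U where "openin B U" "c \<in> U" "\<forall>d\<in>U. u d = u c" using loc[of c] by blast
    then show "\<exists>T. openin B T \<and> c \<in> T \<and> T \<subseteq> ?Q"
      using c openin_subset[of B U] by (intro exI[of _ U]) blast
  qed
  moreover have "openin B (topspace B - ?Q)"
  proof (subst openin_subopen, intro ballI)
    fix c assume c: "c \<in> topspace B - ?Q"
    then obtain U where "openin B U" "c \<in> U" "\<forall>d\<in>U. u d = u c" using loc[of c] by blast
    then show "\<exists>T. openin B T \<and> c \<in> T \<and> T \<subseteq> topspace B - ?Q"
      using c openin_subset[of B U] by (intro exI[of _ U]) blast
  qed
  then have "closedin B ?Q" by (simp add: closedin_def)
  ultimately have "?Q = {} \<or> ?Q = topspace B" using conn connected_space_clopen_in by blast
  moreover have "b \<in> ?Q" using b(1) uniq by (simp add: u_def)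
  ultimately have "b' \<in> ?Q" using b(2) by blast
  then show ?thesis by (simp add: u_def)
qed

lemma topspace_circle: "topspace circle = sphere 0 1"
  by (simp add: circle_def)

lemma connected_space_circle: "connected_space circle"
  by (simp add: circle_def connected_space_subtopology connectedin_iff_connected connected_sphere)

text \<open>\<open>abs_degree\<close> counts the fibre over 1. If the fibre of
  \<open>\<phi> y\<close> were the single point \<open>y\<close>, the fibre over 1 would be a
  singleton too.\<close>

lemma covering_circle_second_preimage:
  assumes cov: "covering_map E circle \<phi>" and deg: "abs_degree E \<phi> \<noteq> 1" and y: "y \<in> topspace E"
  obtains y' where "y' \<in> topspace E" "y' \<noteq> y" "\<phi> y' = \<phi> y"
proof -
  have "\<phi> y \<in> topspace circle" using cov y unfolding covering_map_def by blast
  moreover have "(1::complex) \<in> topspace circle" by (simp add: topspace_circle)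
  moreover have "\<not> (\<exists>!x. x \<in> topspace E \<and> \<phi> x = 1)"
  proof
    assume "\<exists>!x. x \<in> topspace E \<and> \<phi> x = 1"
    then obtain x where "{x \<in> topspace E. \<phi> x = 1} = {x}" by blast
    then show False using deg by (simp add: abs_degree_def)
  qed
  ultimately have "\<not> (\<exists>!x. x \<in> topspace E \<and> \<phi> x = \<phi> y)"
    using covering_map_unique_fibre[OF cov connected_space_circle] by blast
  then show thesis using y that by blast
qed

section \<open>Twisted stratifolds\<close>

lemma openin_real_interval_contains:
  fixes a e :: real
  assumes "openin (top_of_set {a - e<..<a + e}) A" "a \<in> A"
  obtains d where "0 < d" "d \<le> e" "{a - d<..<a + d} \<subseteq> A"
proof -
  have "open A" using assms(1) by (simp add: openin_open_eq)
  then obtain d where d: "d > 0" "ball a d \<subseteq> A" using assms(2) open_contains_ball by blast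
  have sub: "A \<subseteq> {a - e<..<a + e}" using openin_imp_subset[OF assms(1)] .
  then have "0 < e" using assms(2) by auto
  moreover have "{a - min d e<..<a + min d e} \<subseteq> ball a d" by (auto simp: dist_real_def)
  ultimately show thesis using that[of "min d e"] d by auto
qed

text \<open>The boundary point \<open>y\<close> has a second point \<open>y'\<close> in its fibre. The disc is made of a half disc at
  \<open>y\<close> and one at \<open>y'\<close>, where \<open>\<theta>\<close> is the change of boundary parameter given by the covering map.\<close>

lemma disc_centered_in_attached_boundary:
  assumes M: "surface_with_boundary M" and B: "B \<in> boundary_components M"
    and cov: "covering_map (subtopology M B) circle \<phi>"
    and deg: "abs_degree (subtopology M B) \<phi> \<noteq> 1"
    and p: "continuous_map M X p" and inj: "inj_on p (topspace M - surf_boundary M)"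
    and glue: "\<And>x. x \<in> B \<Longrightarrow> p x = r (\<phi> x)" and rinj: "inj_on r (topspace circle)"
    and sep: "\<And>x z. x \<in> topspace M - surf_boundary M \<Longrightarrow> z \<in> topspace circle \<Longrightarrow> p x \<noteq> r z"
    and y: "y \<in> B"
  shows "disc_centered_in X (p ` topspace M) (p y)"
proof -
  define E where "E = subtopology M B"
  have Bs: "B \<subseteq> surf_boundary M"
    using connected_components_of_subset[of B "subtopology M (surf_boundary M)"] B
    by (auto simp: boundary_components_def)
  have BM: "B \<subseteq> topspace M" using subset_trans[OF Bs surf_boundary_subset] .
  have tE: "topspace E = B" using BM by (auto simp: E_def)
  have covE: "covering_map E circle \<phi>" and degE: "abs_degree E \<phi> \<noteq> 1" using cov deg by (simp_all add: E_def)
  have c\<phi>: "continuous_map E circle \<phi>" using covE by (simp add: covering_map_def)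
  have \<phi>B: "\<phi> x \<in> topspace circle" if "x \<in> B" for x
    using continuous_map_image_subset_topspace[OF c\<phi>] that unfolding tE by blast
  obtain y' where "y' \<in> topspace E" and ne: "y' \<noteq> y" and same: "\<phi> y' = \<phi> y"
    using covering_circle_second_preimage[OF covE degE] y unfolding tE by metis
  then have y': "y' \<in> B" by (simp add: tE)
  obtain C \<V> where C: "openin circle C" "\<phi> y \<in> C" and \<V>: "\<Union>\<V> = {x\<in>topspace E. \<phi> x \<in> C}"
    and hom: "\<And>V. V\<in>\<V> \<Longrightarrow> openin E V \<and> homeomorphic_map (subtopology E V) (subtopology circle C) \<phi>"
    using covE \<phi>B[OF y] unfolding covering_map_def by meson
  have "y \<in> \<Union>\<V>" "y' \<in> \<Union>\<V>" using y y' C(2) same unfolding \<V> tE by auto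
  then obtain N N' where N: "N \<in> \<V>" "y \<in> N" and N': "N' \<in> \<V>" "y' \<in> N'" by blast
  have opN: "openin E N" "openin E N'" using hom N N' by blast+
  have NB: "N \<subseteq> B" "N' \<subseteq> B" using openin_subset[OF opN(1)] openin_subset[OF opN(2)] tE by auto
  have tN: "topspace (subtopology E N) = N" "topspace (subtopology E N') = N'" using NB tE by auto
  have tC: "topspace (subtopology circle C) = C" using openin_subset[OF C(1)] by auto
  have injN: "inj_on \<phi> N"
    using homeomorphic_imp_injective_map[of "subtopology E N" "subtopology circle C" \<phi>] hom[OF N(1)]
    by (simp only: tN)
  have \<phi>N: "\<phi> x \<in> C" if "x \<in> N" for x using that N(1) \<V> by blast
  \<comment> \<open>The inverse of \<open>\<phi>\<close> on the sheet around \<open>y'\<close>: it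
    lifts circle points near \<open>\<phi> y\<close> to boundary points near
    \<open>y'\<close>.\<close>
  obtain \<psi> where \<psi>: "homeomorphic_maps (subtopology E N') (subtopology circle C) \<phi> \<psi>"
    using hom[OF N'(1)] homeomorphic_map_maps by blast
  have c\<psi>: "continuous_map (subtopology circle C) (subtopology E N') \<psi>"
    using \<psi> by (simp add: homeomorphic_maps_def)
  have \<psi>N': "\<psi> z \<in> N'" if "z \<in> C" for z
    using continuous_map_image_subset_topspace[OF c\<psi>] that unfolding tN tC by blast
  have \<phi>\<psi>: "\<phi> (\<psi> z) = z" if "z \<in> C" for z using \<psi> that unfolding homeomorphic_maps_def tC by blast
  have \<psi>\<phi>: "\<psi> (\<phi> x) = x" if "x \<in> N'" for x using \<psi> that unfolding homeomorphic_maps_def tN by blast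
  \<comment> \<open>The two half discs must be disjoint in \<open>M\<close>, otherwise the glued map
    would not be injective.\<close>
  have "Hausdorff_space M" using M by (simp add: surface_with_boundary_def)
  then obtain W W' where W: "openin M W" "openin M W'" "y \<in> W" "y' \<in> W'" "disjnt W W'"
    using ne y y' BM unfolding Hausdorff_space_def by (metis subsetD)
  obtain U V g k where ch: "half_chart M U V g k" "y \<in> U" "U \<subseteq> W"
    using surface_half_chart[OF M W(1,3)] .
  obtain U' V' g' k' where ch': "half_chart M U' V' g' k'" "y' \<in> U'" "U' \<subseteq> W'"
    using surface_half_chart[OF M W(2,4)] .
  note D = half_chartD[OF ch(1)] and D' = half_chartD[OF ch'(1)]
  have UU': "U \<inter> U' = {}" using ch(3) ch'(3) W(5) unfolding disjnt_def by blast
  have bd: "k q \<in> surf_boundary M \<longleftrightarrow> snd q = 0" if "q \<in> V" for q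
    using surf_boundary_half_chart_iff[OF ch(1) D(5)[OF that]] D(7)[OF that] by simp
  have bd': "k' q \<in> surf_boundary M \<longleftrightarrow> snd q = 0" if "q \<in> V'" for q
    using surf_boundary_half_chart_iff[OF ch'(1) D'(5)[OF that]] D'(7)[OF that] by simp
  define a where "a = fst (g y)"
  have gy: "g y = (a, 0)"
    using surf_boundary_half_chart_iff[OF ch(1,2)] y Bs by (auto simp: a_def prod_eq_iff)
  define a' where "a' = fst (g' y')"
  have gy': "g' y' = (a', 0)"
    using surf_boundary_half_chart_iff[OF ch'(1,2)] y' Bs by (auto simp: a'_def prod_eq_iff)
  obtain T where T: "open T" "V = {q. 0 \<le> snd q} \<inter> T" using half_chart_open[OF ch(1)] .
  obtain T' where T': "open T'" "V' = {q. 0 \<le> snd q} \<inter> T'" using half_chart_open[OF ch'(1)] .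
  \<comment> \<open>The chart parametrization of the boundary arc through \<open>y\<close>.\<close>
  define \<beta> where "\<beta> s = k (s, 0)" for s
  have "open ((\<lambda>s. (s, 0)) -` T :: real set)"
    by (intro open_vimage T(1) continuous_intros)
  moreover have "a \<in> (\<lambda>s. (s, 0)) -` T" using D(4)[OF ch(2)] T(2) gy by simp
  ultimately obtain e0 where e0: "e0 > 0" "ball a e0 \<subseteq> (\<lambda>s. (s, 0)) -` T"
    using open_contains_ball by blast
  have inV: "(s, 0) \<in> V" if "s \<in> {a - e0<..<a + e0}" for s
    using that e0(2) T(2) by (auto simp: ball_eq_greaterThanLessThan)
  have ya: "\<beta> a = y" using D(6)[OF ch(2)] gy by (simp add: \<beta>_def)
  have cM: "continuous_map (top_of_set {a - e0<..<a + e0}) M \<beta>"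
  proof -
    have "continuous_map (top_of_set {a - e0<..<a + e0}) (top_of_set V) (\<lambda>s. (s, 0))"
      using inV by (auto intro!: continuous_intros)
    then have "continuous_map (top_of_set {a - e0<..<a + e0}) M (k \<circ> (\<lambda>s. (s, 0)))"
      using D(9) continuous_map_compose by blast
    moreover have "k \<circ> (\<lambda>s. (s, 0)) = \<beta>" by (simp add: fun_eq_iff \<beta>_def)
    ultimately show ?thesis by simp
  qed
  \<comment> \<open>The arc is connected, consists of boundary points and meets the component
    \<open>B\<close> in \<open>y\<close>, so it stays in \<open>B\<close>.\<close>
  have \<beta>B: "\<beta> ` {a - e0<..<a + e0} \<subseteq> B"
  proof (rule connected_components_of_maximal)
    show "B \<in> connected_components_of (subtopology M (surf_boundary M))"
      using B by (simp add: boundary_components_def)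
    have "connectedin (top_of_set {a - e0<..<a + e0}) {a - e0<..<a + e0}"
      by (simp add: connectedin_subtopology)
    then have "connectedin M (\<beta> ` {a - e0<..<a + e0})"
      using connectedin_continuous_map_image[OF cM] by blast
    moreover have "\<beta> ` {a - e0<..<a + e0} \<subseteq> surf_boundary M"
      using inV bd by (auto simp: \<beta>_def)
    ultimately show "connectedin (subtopology M (surf_boundary M)) (\<beta> ` {a - e0<..<a + e0})"
      by (simp add: connectedin_subtopology)
    have "y \<in> \<beta> ` {a - e0<..<a + e0}" using ya e0(1) by force
    then show "\<not> disjnt B (\<beta> ` {a - e0<..<a + e0})" using y unfolding disjnt_def by blast
  qed
  have cE: "continuous_map (top_of_set {a - e0<..<a + e0}) E \<beta>"
    using cM \<beta>B unfolding E_def by (simp add: continuous_map_in_subtopology image_subset_iff)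
  have "openin (top_of_set {a - e0<..<a + e0}) {s \<in> {a - e0<..<a + e0}. \<beta> s \<in> N}"
    using openin_continuous_map_preimage[OF cE opN(1)] by simp
  moreover have "a \<in> {s \<in> {a - e0<..<a + e0}. \<beta> s \<in> N}" using ya N(2) e0(1) by simp
  ultimately obtain e1 where e1: "0 < e1" "e1 \<le> e0"
    "{a - e1<..<a + e1} \<subseteq> {s \<in> {a - e0<..<a + e0}. \<beta> s \<in> N}"
    by (rule openin_real_interval_contains)
  \<comment> \<open>The boundary arc through \<open>y'\<close> that covers the same arc of the
    circle as \<open>\<beta>\<close>, with the same parameter.\<close>
  define \<delta> where "\<delta> = \<psi> \<circ> (\<phi> \<circ> \<beta>)"
  have "continuous_map (top_of_set {a - e1<..<a + e1}) (subtopology circle C) (\<phi> \<circ> \<beta>)"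
  proof -
    have "{a - e1<..<a + e1} \<subseteq> {a - e0<..<a + e0}" using e1(3) by blast
    then have "continuous_map (top_of_set {a - e1<..<a + e1}) E \<beta>"
      using continuous_map_from_subtopology_mono[OF cE] by blast
    then have "continuous_map (top_of_set {a - e1<..<a + e1}) circle (\<phi> \<circ> \<beta>)"
      using c\<phi> continuous_map_compose by blast
    moreover have "(\<phi> \<circ> \<beta>) s \<in> C" if "s \<in> {a - e1<..<a + e1}" for s
      using \<phi>N e1(3) that by auto
    ultimately show ?thesis by (simp add: continuous_map_in_subtopology image_subset_iff)
  qed
  then have "continuous_map (top_of_set {a - e1<..<a + e1}) (subtopology E N') \<delta>"
    unfolding \<delta>_def using c\<psi> continuous_map_compose by blast
  then have c\<delta>: "continuous_map (top_of_set {a - e1<..<a + e1}) M \<delta>"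
    unfolding E_def using continuous_map_into_fulltopology by blast
  have \<delta>a: "\<delta> a = y'" using ya same \<psi>\<phi>[OF N'(2)] by (simp add: \<delta>_def)
  have "openin (top_of_set {a - e1<..<a + e1}) {s \<in> {a - e1<..<a + e1}. \<delta> s \<in> U'}"
    using openin_continuous_map_preimage[OF c\<delta> D'(1)] by simp
  moreover have "a \<in> {s \<in> {a - e1<..<a + e1}. \<delta> s \<in> U'}" using \<delta>a ch'(2) e1(1) by simp
  ultimately obtain e2 where e2: "0 < e2" "e2 \<le> e1"
    "{a - e2<..<a + e2} \<subseteq> {s \<in> {a - e1<..<a + e1}. \<delta> s \<in> U'}"
    by (rule openin_real_interval_contains)
  \<comment> \<open>The radii \<open>e0\<close>, \<open>e1\<close>, \<open>e2\<close> successively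
    secure \<open>(s, 0) \<in> V\<close>, \<open>\<beta> s \<in> N\<close> and
    \<open>\<delta> s \<in> U'\<close>.\<close>
  define J where "J = {a - e2<..<a + e2}"
  have J: "(s, 0) \<in> V" "\<beta> s \<in> N" "\<delta> s \<in> U'" "\<delta> s \<in> N'" "\<phi> (\<delta> s) = \<phi> (\<beta> s)" if "s \<in> J" for s
  proof -
    have s: "s \<in> {a - e1<..<a + e1}" and "\<delta> s \<in> U'" using that e2(3) by (auto simp: J_def)
    then show "\<delta> s \<in> U'" by simp
    have "s \<in> {a - e0<..<a + e0}" and bN: "\<beta> s \<in> N" using s e1(3) by auto
    then show "(s, 0) \<in> V" "\<beta> s \<in> N" using inV by auto
    show "\<delta> s \<in> N'" "\<phi> (\<delta> s) = \<phi> (\<beta> s)" using \<psi>N'[OF \<phi>N[OF bN]] \<phi>\<psi>[OF \<phi>N[OF bN]] by (simp_all add: \<delta>_def)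
  qed
  have aJ: "a \<in> J" "open J" using e2(1) by (auto simp: J_def)
  define \<theta> where "\<theta> s = fst (g' (\<delta> s))" for s
  have g'\<delta>: "g' (\<delta> s) = (\<theta> s, 0)" if "s \<in> J" for s
  proof -
    have "\<delta> s \<in> surf_boundary M" using J(4)[OF that] NB Bs by blast
    then show ?thesis
      using surf_boundary_half_chart_iff[OF ch'(1) J(3)[OF that]] by (simp add: \<theta>_def prod_eq_iff)
  qed
  have k'\<theta>: "k' (\<theta> s, 0) = \<delta> s" if "s \<in> J" for s using D'(6)[OF J(3)[OF that]] g'\<delta>[OF that] by simp
  have c\<theta>: "continuous_on J \<theta>"
  proof -
    have "J \<subseteq> {a - e1<..<a + e1}" using e2(3) by (auto simp: J_def)
    then have "continuous_map (top_of_set J) M \<delta>"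
      using continuous_map_from_subtopology_mono[OF c\<delta>] by blast
    then have "continuous_map (top_of_set J) (subtopology M U') \<delta>"
      using J(3) by (simp add: continuous_map_in_subtopology image_subset_iff)
    from continuous_map_compose[OF this D'(8)] have "continuous_on J (g' \<circ> \<delta>)" by simp
    then show ?thesis unfolding \<theta>_def comp_def by (intro continuous_intros)
  qed
  have g\<beta>: "g (\<beta> s) = (s, 0)" if "s \<in> J" for s
    unfolding \<beta>_def by (rule D(7)[OF J(1)[OF that]])
  \<comment> \<open>\<open>\<theta> s\<close> determines \<open>\<delta> s\<close>, hence its circle
    point, hence \<open>\<beta> s\<close> within the sheet \<open>N\<close>, hence
    \<open>s\<close>.\<close>
  have inj\<theta>: "inj_on \<theta> J"
  proof (rule inj_onI)
    fix s t assume s: "s \<in> J" and t: "t \<in> J" and eq: "\<theta> s = \<theta> t"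
    have "\<delta> s = \<delta> t" using k'\<theta>[OF s] k'\<theta>[OF t] eq by simp
    then have "\<phi> (\<beta> s) = \<phi> (\<beta> t)" using J(5)[OF s] J(5)[OF t] by simp
    then have "\<beta> s = \<beta> t" using inj_onD[OF injN _ J(2)[OF s] J(2)[OF t]] by blast
    then have "g (\<beta> s) = g (\<beta> t)" by (rule arg_cong)
    then show "s = t" unfolding g\<beta>[OF s] g\<beta>[OF t] by simp
  qed
  have \<theta>a: "\<theta> a = a'" using g'\<delta>[OF aJ(1)] \<delta>a gy' by simp
  \<comment> \<open>Reflects the lower half disc into the half-plane chart at \<open>y'\<close>; the
    reparametrization by \<open>\<theta>\<close> makes the two halves match on the axis.\<close>
  define flip where "flip q = (\<theta> (fst q), - snd q)" for q :: "real \<times> real"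
  have cflip: "continuous_on (J \<times> UNIV) flip"
    unfolding flip_def by (intro continuous_intros continuous_on_compose2[OF c\<theta>]) auto
  have "open (J \<times> (UNIV :: real set))" using aJ(2) by (intro open_Times) auto
  then have "open (T \<inter> ((J \<times> UNIV) \<inter> flip -` T'))"
    using continuous_open_preimage[OF cflip _ T'(1)] T(1) by blast
  moreover have "(a, 0) \<in> T \<inter> ((J \<times> UNIV) \<inter> flip -` T')"
  proof -
    have "(a, 0) \<in> T" using D(4)[OF ch(2)] T(2) gy by simp
    moreover have "(a', 0) \<in> T'" using D'(4)[OF ch'(2)] T'(2) gy' by simp
    ultimately show ?thesis using aJ(1) \<theta>a by (simp add: flip_def)
  qed
  ultimately obtain d where d: "d > 0" "ball (a, 0) d \<subseteq> T \<inter> ((J \<times> UNIV) \<inter> flip -` T')"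
    using open_contains_ball by blast
  let ?D = "ball (a, 0::real) d"
  have DJ: "fst q \<in> J" if "q \<in> ?D" for q using that d(2) by auto
  have DV: "q \<in> V" if "q \<in> ?D" "0 \<le> snd q" for q using that d(2) T(2) by auto
  have DV': "flip q \<in> V'" if "q \<in> ?D" "snd q \<le> 0" for q
    using that d(2) T'(2) by (auto simp: flip_def)
  define G where "G q = (if 0 \<le> snd q then p (k q) else p (k' (flip q)))" for q
  \<comment> \<open>\<open>\<beta>\<close> and \<open>\<delta>\<close> lie over the same circle
    point, so the gluing identifies the two formulas for \<open>G\<close> on the axis.\<close>
  have axis: "p (k q) = r (\<phi> (\<beta> (fst q)))" "p (k' (flip q)) = r (\<phi> (\<beta> (fst q)))"
    if q: "q \<in> ?D" "snd q = 0" for q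
  proof -
    have q0: "q = (fst q, 0)" using q(2) by (simp add: prod_eq_iff)
    note j = DJ[OF q(1)]
    have "k q = \<beta> (fst q)" using q0 by (simp add: \<beta>_def)
    then show "p (k q) = r (\<phi> (\<beta> (fst q)))" using glue[of "\<beta> (fst q)"] J(2)[OF j] NB by auto
    have "k' (flip q) = \<delta> (fst q)" using k'\<theta>[OF j] q(2) by (simp add: flip_def)
    then show "p (k' (flip q)) = r (\<phi> (\<beta> (fst q)))"
      using glue[of "\<delta> (fst q)"] J(4,5)[OF j] NB by auto
  qed
  have contG: "continuous_map (top_of_set ?D) X G"
    unfolding G_def
  proof (rule continuous_map_cases_le)
    let ?S = "{q \<in> topspace (top_of_set ?D). 0 \<le> snd q}" and ?S' = "{q \<in> topspace (top_of_set ?D). snd q \<le> 0}"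
    have "continuous_map (top_of_set ?S) M k"
      by (rule continuous_map_from_subtopology_mono[OF D(9)]) (use DV in auto)
    then have "continuous_map (top_of_set ?S) X (p \<circ> k)" using p continuous_map_compose by blast
    then show "continuous_map (subtopology (top_of_set ?D) ?S) X (\<lambda>q. p (k q))"
      by (simp add: subtopology_subtopology comp_def Int_absorb1 subset_iff)
    have "continuous_on ?S' flip"
      by (rule continuous_on_subset[OF cflip]) (use DJ in \<open>auto simp: mem_Times_iff\<close>)
    then have "continuous_map (top_of_set ?S') (top_of_set V') flip"
      using DV' by (auto simp: continuous_map_in_subtopology)
    from continuous_map_compose[OF continuous_map_compose[OF this D'(9)] p]
    have "continuous_map (top_of_set ?S') X (p \<circ> (k' \<circ> flip))" .
    then show "continuous_map (subtopology (top_of_set ?D) ?S') X (\<lambda>q. p (k' (flip q)))"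
      by (simp add: subtopology_subtopology comp_def Int_absorb1 subset_iff)
    show "p (k q) = p (k' (flip q))" if "q \<in> topspace (top_of_set ?D)" "0 = snd q" for q
      using axis[of q] that by simp
  qed (auto intro!: continuous_intros)
  have up: "k q \<in> topspace M - surf_boundary M" "G q = p (k q)" "k q \<in> U" "g (k q) = q"
    if "q \<in> ?D" "0 < snd q" for q
    using DV[of q] bd[of q] D(2) D(5)[of q] D(7)[of q] that by (auto simp: G_def)
  have down: "k' (flip q) \<in> topspace M - surf_boundary M" "G q = p (k' (flip q))" "k' (flip q) \<in> U'"
    "g' (k' (flip q)) = flip q" if "q \<in> ?D" "snd q < 0" for q
  proof -
    have v: "flip q \<in> V'" using DV'[of q] that by simp
    have "snd (flip q) \<noteq> 0" using that by (simp add: flip_def)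
    then show "k' (flip q) \<in> topspace M - surf_boundary M" "G q = p (k' (flip q))" "k' (flip q) \<in> U'"
      "g' (k' (flip q)) = flip q"
      using bd'[OF v] D'(2) D'(5)[OF v] D'(7)[OF v] that by (auto simp: G_def)
  qed
  have mid: "G q = r (\<phi> (\<beta> (fst q)))" "\<phi> (\<beta> (fst q)) \<in> topspace circle" if "q \<in> ?D" "snd q = 0" for q
    using axis(1)[OF that] that(2) \<phi>B J(2)[OF DJ[OF that(1)]] NB by (auto simp: G_def)
  have injG: "inj_on G ?D"
  proof (rule inj_onI)
    fix q q' assume q: "q \<in> ?D" "q' \<in> ?D" and eq: "G q = G q'"
    \<comment> \<open>Points in one open half are separated by its chart, points in opposite halves
      by the disjointness of \<open>U\<close> and \<open>U'\<close>, an interior point from an axis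
      point by \<open>sep\<close>, and two axis points by injectivity of \<open>r\<close> and of
      \<open>\<phi>\<close> on \<open>N\<close>.\<close>
    consider "0 < snd q" "0 < snd q'" | "0 < snd q" "snd q' = 0" | "0 < snd q" "snd q' < 0"
      | "snd q = 0" "0 < snd q'" | "snd q = 0" "snd q' = 0" | "snd q = 0" "snd q' < 0"
      | "snd q < 0" "0 < snd q'" | "snd q < 0" "snd q' = 0" | "snd q < 0" "snd q' < 0" by linarith
    then show "q = q'"
    proof cases
      case 1
      have "p (k q) = p (k q')" using eq by (simp only: up(2)[OF q(1) 1(1)] up(2)[OF q(2) 1(2)])
      then have "k q = k q'" by (rule inj_onD[OF inj _ up(1)[OF q(1) 1(1)] up(1)[OF q(2) 1(2)]])
      then have "g (k q) = g (k q')" by (rule arg_cong)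
      then show ?thesis by (simp only: up(4)[OF q(1) 1(1)] up(4)[OF q(2) 1(2)])
    next
      case 2
      then show ?thesis
        using sep[OF up(1)[OF q(1) 2(1)] mid(2)[OF q(2) 2(2)]] eq up(2)[OF q(1)] mid(1)[OF q(2)] by simp
    next
      case 3
      have "p (k q) = p (k' (flip q'))" using eq by (simp only: up(2)[OF q(1) 3(1)] down(2)[OF q(2) 3(2)])
      then have "k q = k' (flip q')" by (rule inj_onD[OF inj _ up(1)[OF q(1) 3(1)] down(1)[OF q(2) 3(2)]])
      then show ?thesis using up(3)[OF q(1) 3(1)] down(3)[OF q(2) 3(2)] UU' by auto
    next
      case 4
      then show ?thesis
        using sep[OF up(1)[OF q(2) 4(2)] mid(2)[OF q(1) 4(1)]] eq up(2)[OF q(2)] mid(1)[OF q(1)] by simp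
    next
      case 5
      have "\<phi> (\<beta> (fst q)) = \<phi> (\<beta> (fst q'))"
        using inj_onD[OF rinj _ mid(2)[OF q(1) 5(1)] mid(2)[OF q(2) 5(2)]] mid(1) q 5 eq by simp
      then have "\<beta> (fst q) = \<beta> (fst q')"
        using inj_onD[OF injN _ J(2)[OF DJ[OF q(1)]] J(2)[OF DJ[OF q(2)]]] by blast
      then have "g (\<beta> (fst q)) = g (\<beta> (fst q'))" by (rule arg_cong)
      then have "fst q = fst q'" unfolding g\<beta>[OF DJ[OF q(1)]] g\<beta>[OF DJ[OF q(2)]] by simp
      then show ?thesis using 5 by (simp add: prod_eq_iff)
    next
      case 6
      then show ?thesis
        using sep[OF down(1)[OF q(2) 6(2)] mid(2)[OF q(1) 6(1)]] eq down(2)[OF q(2)] mid(1)[OF q(1)] by simp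
    next
      case 7
      have "p (k' (flip q)) = p (k q')" using eq by (simp only: down(2)[OF q(1) 7(1)] up(2)[OF q(2) 7(2)])
      then have "k' (flip q) = k q'" by (rule inj_onD[OF inj _ down(1)[OF q(1) 7(1)] up(1)[OF q(2) 7(2)]])
      then show ?thesis using down(3)[OF q(1) 7(1)] up(3)[OF q(2) 7(2)] UU' by auto
    next
      case 8
      then show ?thesis
        using sep[OF down(1)[OF q(1) 8(1)] mid(2)[OF q(2) 8(2)]] eq down(2)[OF q(1)] mid(1)[OF q(2)] by simp
    next
      case 9
      have "p (k' (flip q)) = p (k' (flip q'))"
        using eq by (simp only: down(2)[OF q(1) 9(1)] down(2)[OF q(2) 9(2)])
      then have "k' (flip q) = k' (flip q')"
        by (rule inj_onD[OF inj _ down(1)[OF q(1) 9(1)] down(1)[OF q(2) 9(2)]])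
      then have "g' (k' (flip q)) = g' (k' (flip q'))" by (rule arg_cong)
      then have "flip q = flip q'" by (simp only: down(4)[OF q(1) 9(1)] down(4)[OF q(2) 9(2)])
      then have "\<theta> (fst q) = \<theta> (fst q')" "snd q = snd q'" by (simp_all add: flip_def)
      then show ?thesis using inj_onD[OF inj\<theta> _ DJ[OF q(1)] DJ[OF q(2)]] by (simp add: prod_eq_iff)
    qed
  qed
  have "G ` ?D \<subseteq> p ` topspace M"
  proof (rule image_subsetI)
    fix q assume q: "q \<in> ?D"
    show "G q \<in> p ` topspace M"
      using DV[OF q] DV'[OF q] D(2) D(5)[of q] D'(2) D'(5)[of "flip q"] by (auto simp: G_def)
  qed
  moreover have "G (a, 0) = p y" using ya by (simp add: G_def \<beta>_def)
  ultimately show ?thesis using d(1) contG injG unfolding disc_centered_in_def by blast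
qed

text \<open>Closedness comes from compact images in a Hausdorff space, openness from the quotient
  topology, and discs from the interior or boundary construction, depending on where a preimage of
  the point lies.\<close>

lemma twisted_two_stratifold_disc_cover:
  assumes tw: "twisted_two_stratifold X n M m att phi p r"
  shows "disc_cover X n (\<lambda>i. p i ` topspace (M i)) (\<lambda>i. p i ` (topspace (M i) - surf_boundary (M i)))"
proof -
  let ?I = "\<lambda>i. topspace (M i) - surf_boundary (M i)"
  note tw' = tw[unfolded twisted_two_stratifold_def]
  have haus: "Hausdorff_space X"
    using tw' by (elim conjE) blast
  have surf: "\<And>i. i < n \<Longrightarrow> surface_with_boundary (M i)"
    using tw' by (elim conjE) blast
  have comp: "\<And>i. i < n \<Longrightarrow> compact_space (M i)"
    using tw' by (elim conjE) blast
  have bne: "\<And>i. i < n \<Longrightarrow> surf_boundary (M i) \<noteq> {}"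
    using tw' by (elim conjE) blast
  have att: "\<And>i B. i < n \<Longrightarrow> B \<in> boundary_components (M i) \<Longrightarrow> att i B < m"
    using tw' by (elim conjE) blast
  have cov: "\<And>i B. i < n \<Longrightarrow> B \<in> boundary_components (M i) \<Longrightarrow>
        covering_map (subtopology (M i) B) circle (phi i B)"
    using tw' by (elim conjE) blast
  have deg: "\<And>i B. i < n \<Longrightarrow> B \<in> boundary_components (M i) \<Longrightarrow>
        abs_degree (subtopology (M i) B) (phi i B) \<noteq> 1"
    using tw' by (elim conjE) blast
  have sums: "\<And>j. j < m \<Longrightarrow> (\<Sum>(i,B)\<in>{(i,B). i < n \<and> B \<in> boundary_components (M i) \<and> att i B = j}.
              abs_degree (subtopology (M i) B) (phi i B)) > 2"
    using tw' by (elim conjE) blast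
  have contp: "\<And>i. i < n \<Longrightarrow> continuous_map (M i) X (p i)"
    using tw' by (elim conjE) blast
  have top: "topspace X = (\<Union>i<n. p i ` topspace (M i)) \<union> (\<Union>j<m. r j ` topspace circle)"
    using tw' by (elim conjE) blast
  have quot: "\<forall>U. U \<subseteq> topspace X \<longrightarrow>
        (openin X U \<longleftrightarrow> (\<forall>i<n. openin (M i) {x\<in>topspace (M i). p i x \<in> U}) \<and>
                          (\<forall>j<m. openin circle {z\<in>topspace circle. r j z \<in> U}))"
    using tw' by (elim conjE) assumption
  have "\<forall>i<n. \<forall>B\<in>boundary_components (M i). \<forall>x\<in>B. p i x = r (att i B) (phi i B x)"
    using tw' by (elim conjE) assumption
  then have glue: "p i x = r (att i B) (phi i B x)" if "i < n" "B \<in> boundary_components (M i)" "x \<in> B" for i B x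
    using that by blast
  have "\<forall>i i' x x'. i < n \<and> i' < n \<and> x \<in> ?I i \<and> x' \<in> ?I i' \<and> p i x = p i' x' \<longrightarrow> i = i' \<and> x = x'"
    using tw' by (elim conjE) assumption
  then have injp: "i = i' \<and> x = x'" if "i < n" "i' < n" "x \<in> ?I i" "x' \<in> ?I i'" "p i x = p i' x'" for i i' x x'
    using that by blast
  have "\<forall>i x j z. i < n \<and> x \<in> ?I i \<and> j < m \<and> z \<in> topspace circle \<longrightarrow> p i x \<noteq> r j z"
    using tw' by (elim conjE) assumption
  then have sep: "p i x \<noteq> r j z" if "i < n" "x \<in> ?I i" "j < m" "z \<in> topspace circle" for i x j z
    using that by blast
  have "\<forall>j j' z z'. j < m \<and> j' < m \<and> z \<in> topspace circle \<and> z' \<in> topspace circle \<and>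
        r j z = r j' z' \<longrightarrow> j = j' \<and> z = z'"
    using tw' by (elim conjE) assumption
  then have injr: "z = z'" if "j < m" "z \<in> topspace circle" "z' \<in> topspace circle" "r j z = r j z'" for j z z'
    using that by blast
  have inj: "inj_on (p i) (?I i)" if "i < n" for i
    using injp[OF that that] by (intro inj_onI) blast
  have bcomp: "\<exists>B\<in>boundary_components (M i). x \<in> B" if "x \<in> surf_boundary (M i)" for i x
  proof -
    have "x \<in> topspace (subtopology (M i) (surf_boundary (M i)))" using that surf_boundary_subset by fastforce
    then show ?thesis unfolding boundary_components_def Union_connected_components_of[symmetric] by blast
  qed
  have bB: "phi i B x \<in> topspace circle" if "i < n" "B \<in> boundary_components (M i)" "x \<in> B" for i B x
  proof -
    have "B \<subseteq> topspace (M i)"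
      using connected_components_of_subset[of B "subtopology (M i) (surf_boundary (M i))"] that(2)
      by (auto simp: boundary_components_def)
    then have "x \<in> topspace (subtopology (M i) B)" using that(3) by auto
    then show ?thesis using cov[OF that(1,2)] unfolding covering_map_def by blast
  qed
  \<comment> \<open>Boundary points are glued to circles, and circles miss the images of
    interiors.\<close>
  have sepb: "p i x \<noteq> p k z"
    if i: "i < n" and k: "k < n" and x: "x \<in> ?I i" and z: "z \<in> surf_boundary (M k)" for i k x z
  proof -
    obtain B where B: "B \<in> boundary_components (M k)" "z \<in> B" using bcomp[OF z] by blast
    show ?thesis using sep[OF i x att[OF k B(1)] bB[OF k B]] glue[OF k B] by simp
  qed
  \<comment> \<open>A set of interior points of \<open>M i\<close> is saturated: its image pulls
    back to the set itself in \<open>M i\<close> and to the empty set in the other surfaces and in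
    the circles.\<close>
  have open_image: "openin X (p i ` U)" if i: "i < n" and U: "openin (M i) U" "U \<subseteq> ?I i" for i U
  proof -
    have "p i ` U \<subseteq> topspace X" using top i U(2) by blast
    moreover have "openin (M k) {x\<in>topspace (M k). p k x \<in> p i ` U}" if k: "k < n" for k
    proof -
      have "{x\<in>topspace (M k). p k x \<in> p i ` U} = (if k = i then U else {})"
      proof (intro equalityI subsetI)
        fix x assume "x \<in> {x\<in>topspace (M k). p k x \<in> p i ` U}"
        then obtain u where u: "x \<in> topspace (M k)" "u \<in> U" "p k x = p i u" by blast
        have "x \<in> ?I k" using u U(2) sepb[OF i k, of u x] by auto
        then have "k = i \<and> x = u" using injp[OF k i _ _ u(3)] u(2) U(2) by blast
        then show "x \<in> (if k = i then U else {})" using u(2) by simp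
      next
        fix x assume "x \<in> (if k = i then U else {})"
        then show "x \<in> {x\<in>topspace (M k). p k x \<in> p i ` U}" using U(2) by (auto split: if_splits)
      qed
      then show ?thesis using U(1) by simp
    qed
    moreover have "{z\<in>topspace circle. r j z \<in> p i ` U} = {}" if "j < m" for j
      using sep[OF i _ that] U(2) by fastforce
    ultimately show ?thesis using quot[rule_format, of "p i ` U"] by (metis (lifting) openin_empty)
  qed
  show ?thesis
  proof
    show "closedin X (p i ` topspace (M i))" if "i < n" for i
      using comp[OF that] contp[OF that] haus image_compactin compactin_imp_closedin
      unfolding compact_space_def by blast
    show "openin X (p i ` ?I i)" if "i < n" for i
      using open_image[OF that surface_interior_open[OF surf[OF that]]] by blast
    show "p i ` ?I i \<noteq> {}" if i: "i < n" for i
    proof -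
      obtain x where "x \<in> surf_boundary (M i)" using bne[OF i] by blast
      then have "x \<in> topspace (M i)" by (rule subsetD[OF surf_boundary_subset])
      from surface_interior_dense[OF surf[OF i] openin_topspace this] show ?thesis by blast
    qed
    show "p i ` ?I i \<subseteq> p i ` topspace (M i)" for i by blast
    show "W \<inter> p i ` ?I i \<noteq> {}" if i: "i < n" and W: "openin X W" "W \<inter> p i ` topspace (M i) \<noteq> {}" for i W
    proof -
      obtain x where "x \<in> {x \<in> topspace (M i). p i x \<in> W}" using W(2) by blast
      from surface_interior_dense[OF surf[OF i] openin_continuous_map_preimage[OF contp[OF i] W(1)] this]
      show ?thesis by blast
    qed
    show "p i ` ?I i \<inter> p k ` topspace (M k) = {}" if "i < n" "k < n" "i \<noteq> k" for i k
    proof -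
      have "p i x \<noteq> p k z" if "x \<in> ?I i" "z \<in> topspace (M k)" for x z
        using sepb[OF \<open>i < n\<close> \<open>k < n\<close> that(1)] injp[OF \<open>i < n\<close> \<open>k < n\<close> that(1), of z] that(2) \<open>i \<noteq> k\<close>
        by blast
      then show ?thesis by blast
    qed
    show "topspace X = (\<Union>i<n. p i ` topspace (M i))"
    proof -
      have "r j z \<in> (\<Union>i<n. p i ` topspace (M i))" if j: "j < m" and z: "z \<in> topspace circle" for j z
      proof -
        \<comment> \<open>An empty sum is 0, so every circle has a boundary curve attached; that
          curve covers the circle, and the surfaces alone exhaust \<open>X\<close>.\<close>
        have "{(i,B). i < n \<and> B \<in> boundary_components (M i) \<and> att i B = j} \<noteq> {}"
          using sums[OF j] by force
        then obtain i B where B: "i < n" "B \<in> boundary_components (M i)" "att i B = j" by blast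
        have "phi i B ` topspace (subtopology (M i) B) = topspace circle"
          using cov[OF B(1,2)] by (simp add: covering_map_def)
        then have "z \<in> phi i B ` topspace (subtopology (M i) B)" using z by simp
        then obtain x where x: "x \<in> topspace (M i)" "x \<in> B" "phi i B x = z" by auto
        then have "r j z = p i x" using glue[OF B(1,2) x(2)] B(3) by simp
        then show ?thesis using x(1) B(1) by blast
      qed
      then have "(\<Union>j<m. r j ` topspace circle) \<subseteq> (\<Union>i<n. p i ` topspace (M i))" by blast
      then show ?thesis unfolding top by (rule Un_absorb2)
    qed
    show "disc_centered_in X (p i ` topspace (M i)) x" if i: "i < n" and x: "x \<in> p i ` topspace (M i)" for i x
    proof -
      obtain y where y: "y \<in> topspace (M i)" "x = p i y" using x by blast
      show ?thesis
      proof (cases "y \<in> surf_boundary (M i)")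
        case True
        then obtain B where B: "B \<in> boundary_components (M i)" "y \<in> B" using bcomp[of y i] by blast
        show ?thesis unfolding y(2)
        proof (rule disc_centered_in_attached_boundary[OF surf[OF i] B(1) cov[OF i B(1)] deg[OF i B(1)]
              contp[OF i] inj[OF i] _ _ _ B(2)])
          show "p i x = r (att i B) (phi i B x)" if "x \<in> B" for x using glue[OF i B(1) that] .
          show "inj_on (r (att i B)) (topspace circle)"
            using injr[OF att[OF i B(1)]] by (intro inj_onI) blast
          show "p i x \<noteq> r (att i B) z" if "x \<in> ?I i" "z \<in> topspace circle" for x z
            using sep[OF i that(1) att[OF i B(1)] that(2)] .
        qed
      next
        case False
        then show ?thesis
          using disc_centered_in_surface_interior[OF surf[OF i] contp[OF i] inj[OF i]] y by simp
      qed
    qed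
    show "\<exists>U (g :: _ \<Rightarrow> real\<times>real). openin X U \<and> x \<in> U \<and> continuous_map (subtopology X U) euclidean g \<and> inj_on g U"
      if i: "i < n" and x: "x \<in> p i ` ?I i" for i x
    proof -
      obtain y where y: "y \<in> ?I i" "x = p i y" using x by blast
      obtain U V g k where ch: "half_chart (M i) U V g k" "y \<in> U" "U \<subseteq> ?I i"
        using surface_half_chart[OF surf[OF i] surface_interior_open[OF surf[OF i]] y(1)] .
      note D = half_chartD[OF ch(1)]
      have tU: "topspace (subtopology (M i) U) = U" using D(2) by auto
      have opU: "openin X (p i ` U)" using open_image[OF i D(1) ch(3)] .
      have tpU: "topspace (subtopology X (p i ` U)) = p i ` U" using openin_subset[OF opU] by auto
      \<comment> \<open>On interior points \<open>p i\<close> is injective and open, so the chart of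
        \<open>M i\<close> descends to a planar chart of \<open>X\<close>.\<close>
      have "homeomorphic_map (subtopology (M i) U) (subtopology X (p i ` U)) (p i)"
      proof (rule bijective_open_imp_homeomorphic_map)
        show "continuous_map (subtopology (M i) U) (subtopology X (p i ` U)) (p i)"
          using contp[OF i] by (auto simp: continuous_map_in_subtopology continuous_map_from_subtopology)
        show "open_map (subtopology (M i) U) (subtopology X (p i ` U)) (p i)"
          unfolding open_map_def
        proof (intro allI impI)
          fix W assume W: "openin (subtopology (M i) U) W"
          have WU: "W \<subseteq> U" using openin_subset[OF W] unfolding tU .
          have "openin X (p i ` W)"
            using open_image[OF i openin_trans_full[OF W D(1)]] WU ch(3) by blast
          then show "openin (subtopology X (p i ` U)) (p i ` W)"
            using WU opU by (simp add: openin_open_subtopology image_mono)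
        qed
        show "p i ` topspace (subtopology (M i) U) = topspace (subtopology X (p i ` U))"
          by (simp only: tU tpU)
        show "inj_on (p i) (topspace (subtopology (M i) U))"
          unfolding tU using inj_on_subset[OF inj[OF i] ch(3)] .
      qed
      then obtain l where l: "homeomorphic_maps (subtopology (M i) U) (subtopology X (p i ` U)) (p i) l"
        using homeomorphic_map_maps by blast
      have cl: "continuous_map (subtopology X (p i ` U)) (subtopology (M i) U) l"
        and lp: "\<And>u. u \<in> U \<Longrightarrow> l (p i u) = u"
        using l unfolding homeomorphic_maps_def tU by blast+
      have "continuous_map (subtopology X (p i ` U)) euclidean (g \<circ> l)"
        using continuous_map_compose[OF cl D(8)] .
      moreover have "inj_on (g \<circ> l) (p i ` U)"
      proof (rule inj_onI)
        fix a b assume "a \<in> p i ` U" "b \<in> p i ` U" and eq: "(g \<circ> l) a = (g \<circ> l) b"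
        then obtain u v where uv: "u \<in> U" "a = p i u" "v \<in> U" "b = p i v" by blast
        have "g u = g v" using eq unfolding comp_apply uv(2,4) lp[OF uv(1)] lp[OF uv(3)] .
        then have "k (g u) = k (g v)" by (rule arg_cong)
        then show "a = b" unfolding D(6)[OF uv(1)] D(6)[OF uv(3)] uv(2,4) by (rule arg_cong)
      qed
      ultimately show ?thesis using opU y(2) ch(2) by blast
    qed
  qed
qed

theorem theorem15:
  fixes X :: "'x topology" and n m :: nat and M :: "nat \<Rightarrow> 'a topology"
    and att :: "nat \<Rightarrow> 'a set \<Rightarrow> nat" and phi :: "nat \<Rightarrow> 'a set \<Rightarrow> 'a \<Rightarrow> complex"
    and p :: "nat \<Rightarrow> 'a \<Rightarrow> 'x" and r :: "nat \<Rightarrow> complex \<Rightarrow> 'x"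
    and K :: "'v set set" and f :: "'v set \<Rightarrow> real"
  assumes "twisted_two_stratifold X n M m att phi p r"
    and "triangulates K X"
    and "discrete_morse K f"
  shows "m2 K f \<ge> n"
proof -
  have K: "simplicial_complex K" and "geometric_realization K homeomorphic_space X"
    using assms(2) by (simp_all add: triangulates_def)
  then obtain h k where "homeomorphic_maps X (top_of_set (realization_points K)) h k"
    unfolding homeomorphic_space_def geometric_realization_eq using homeomorphic_maps_sym by blast
  from disc_cover.homeomorphic_image[OF twisted_two_stratifold_disc_cover[OF assms(1)] this]
  have "triangulated_disc_cover K n (\<lambda>i. h ` p i ` topspace (M i))
      (\<lambda>i. h ` p i ` (topspace (M i) - surf_boundary (M i)))"
    using K by (simp add: triangulated_disc_cover_def triangulated_disc_cover_axioms_def)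
  from triangulated_disc_cover.m2_ge[OF this assms(3)] show ?thesis .
qed

end
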